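(* Let $G$ be a finite group and $M$ a covariant coefficient system for $G$. Let $X$ be a pointed $G$-space of the ($G$-)homotopy type of a $G$-CW-complex. Assume that the fixed point space $X^H$ is connected for each subgroup $H\subset G$. Then $\widetilde H^G_0(X;M)=0$, where $\widetilde H^G_*(-;M)$ is reduced Bredon-Illman $G$-equivariant homology with coefficients in $M$.
   Context: Pointed $G$-spaces and pointed $G$-sets have a $G$-fixed base point $x_0$; $G_x$ is the isotropy group of $x$. Spaces are k-spaces ($X$ is a k-space if $W\subset X$ is closed whenever $f^{-1}(W)$ is closed for every continuous $f:Z\to X$, $Z$ compact Hausdorff). A covariant coefficient system is a covariant functor $M$ from the orbit category $\mathcal O(G)$ (objects $G/H$; morphisms $G$-functions) to $R$-modules, $R$ a commutative ring; $M_*(\alpha)$ is the homomorphism induced by $\alpha$. For a pointed $G$-set $S$, $F(S,M)$ is the $R$-module of functions $u:S\to\bigcup_{H\subset G}M(G/H)$ with $u(x)\in M(G/G_x)$, $u(x_0)=0$ and $u(x)=0$ for all but finitely many $x$; $lx$ ($l\in M(G/G_x)$) is the function with value $l$ at $x$ and $0$ elsewhere ($lx_0=0$). $G$ acts by $g\cdot(lx)=M_*(R_{g^{-1}})(l)(gx)$, where $R_{g^{-1}}:G/G_x\to G/G_{gx}$, $aG_x\mapsto ag^{-1}G_{gx}$. The fixed submodule $F(S,M)^G$ is generated by the elements $\gamma^G_x(l)=\sum_{[g]\in G/G_x}M_*(R_{g^{-1}})(l)(gx)$. $F^G(S,M)$ denotes $F(S,M)^G$ made functorial in pointed $G$-functions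 $f:S\to T$ by $f^G_*(\gamma^G_x(l))=\gamma^G_{f(x)}(M_*(\widehat f_x)(l))$, with $\widehat f_x:G/G_x\to G/G_{f(x)}$ the canonical projection. Let $\mathcal S(X)$ be the singular simplicial pointed $G$-set of $X$ ($\mathcal S_q(X)$ = continuous maps $\Delta^q\to X$, based at the constant simplex). $\widetilde H^G_q(X;M)$ is the $q$th homology of the chain complex $F^G(\mathcal S_q(X),M)$ with differential $\sum_{i=0}^q(-1)^i(d_i)^G_*$; this complex is isomorphic to Illman's equivariant singular chain complex of $(X,x_0)$ with coefficients in $M$. *)

theory Defs
  imports
    "HOL-Analysis.Analysis"
    "HOL-Homology.Homology"
    "HOL-Algebra.Group_Action"
    "HOL-Algebra.Left_Coset"
    "HOL-Algebra.Module"
begin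

section \<open>Spaces\<close>

text \<open>
  A space is a k-space if closedness is detected by continuous maps from compact Hausdorff spaces.
  HOL cannot quantify over types inside a formula, so the test spaces live on a type \<open>'z\<close> passed as
  a parameter.  The non-closed subsets of a given space form a set, hence set-many test spaces
  suffice: a space is a k-space iff it satisfies this predicate for some (large enough) \<open>'z\<close>, and a
  theorem assuming it for an arbitrary \<open>'z\<close> covers all k-spaces.
  The constant \<^const>\<open>k_space\<close> of HOL-Analysis tests with compact subsets instead, which is a
  different notion for non-Hausdorff spaces.
\<close>

definition k_space_wrt :: "'z itself \<Rightarrow> 'x topology \<Rightarrow> bool" where
  "k_space_wrt (ty :: 'z itself) X \<longleftrightarrow>
     (\<forall>W \<subseteq> topspace X.
        (\<forall>(Z :: 'z topology) f.
            compact_space Z \<and> Hausdorff_space Z \<and> continuous_map Z X f \<longrightarrow>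
            closedin Z {z \<in> topspace Z. f z \<in> W})
        \<longrightarrow> closedin X W)"

definition G_space ::
    "('g, 'b) monoid_scheme \<Rightarrow> 'x topology \<Rightarrow> ('g \<Rightarrow> 'x \<Rightarrow> 'x) \<Rightarrow> bool" where
  "G_space G X \<phi> \<longleftrightarrow>
     group_action G (topspace X) \<phi> \<and> (\<forall>g \<in> carrier G. continuous_map X X (\<phi> g))"

definition pointed_G_space ::
    "('g, 'b) monoid_scheme \<Rightarrow> 'x topology \<Rightarrow> ('g \<Rightarrow> 'x \<Rightarrow> 'x) \<Rightarrow> 'x \<Rightarrow> bool" where
  "pointed_G_space G X \<phi> x0 \<longleftrightarrow>
     G_space G X \<phi> \<and> x0 \<in> topspace X \<and> (\<forall>g \<in> carrier G. \<phi> g x0 = x0)"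

definition fixed_points :: "'x topology \<Rightarrow> ('g \<Rightarrow> 'x \<Rightarrow> 'x) \<Rightarrow> 'g set \<Rightarrow> 'x set" where
  "fixed_points X \<phi> H = {x \<in> topspace X. \<forall>h \<in> H. \<phi> h x = x}"

definition equivariant ::
    "('g, 'b) monoid_scheme \<Rightarrow> 'x set \<Rightarrow> ('g \<Rightarrow> 'x \<Rightarrow> 'x) \<Rightarrow> ('g \<Rightarrow> 'y \<Rightarrow> 'y) \<Rightarrow> ('x \<Rightarrow> 'y) \<Rightarrow> bool"
  where
  "equivariant G S \<phi> \<psi> f \<longleftrightarrow> (\<forall>g \<in> carrier G. \<forall>x \<in> S. f (\<phi> g x) = \<psi> g (f x))"

text \<open>The stages of a \<open>G\<close>-homotopy \<open>[0,1] \<times> X \<rightarrow> Y\<close> (\<open>G\<close> acting trivially on \<open>[0,1]\<close>) are equivariant.\<close>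

definition G_homotopic where
  "G_homotopic G X \<phi> Y \<psi> = homotopic_with (equivariant G (topspace X) \<phi> \<psi>) X Y"

definition G_homotopy_equivalent ::
    "('g, 'b) monoid_scheme \<Rightarrow> 'x topology \<Rightarrow> ('g \<Rightarrow> 'x \<Rightarrow> 'x)
      \<Rightarrow> 'y topology \<Rightarrow> ('g \<Rightarrow> 'y \<Rightarrow> 'y) \<Rightarrow> bool" where
  "G_homotopy_equivalent G X \<phi> Y \<psi> \<longleftrightarrow>
     (\<exists>f h. continuous_map X Y f \<and> equivariant G (topspace X) \<phi> \<psi> f \<and>
            continuous_map Y X h \<and> equivariant G (topspace Y) \<psi> \<phi> h \<and>
            G_homotopic G X \<phi> X \<phi> (h \<circ> f) id \<and>
            G_homotopic G Y \<psi> Y \<psi> (f \<circ> h) id)"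


section \<open>\<open>G\<close>-CW-complexes (\<open>G\<close> discrete)\<close>

definition disk :: "nat \<Rightarrow> (nat \<Rightarrow> real) set" where
  "disk n = {x. (\<forall>i\<ge>n. x i = 0) \<and> (\<Sum>i<n. (x i)\<^sup>2) \<le> 1}"

text \<open>The sphere \<open>S\<^sup>n\<^sup>-\<^sup>1\<close> bounding \<^term>\<open>disk n\<close>; it is empty for \<open>n = 0\<close>.\<close>

definition disk_boundary :: "nat \<Rightarrow> (nat \<Rightarrow> real) set" where
  "disk_boundary n = {x. (\<forall>i\<ge>n. x i = 0) \<and> (\<Sum>i<n. (x i)\<^sup>2) = 1}"

text \<open>The space \<open>G/H \<times> D\<^sup>n\<close>.\<close>

definition G_cell ::
    "('g, 'b) monoid_scheme \<Rightarrow> nat \<Rightarrow> 'g set \<Rightarrow> ('g set \<times> (nat \<Rightarrow> real)) topology" where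
  "G_cell G n H =
     prod_topology (discrete_topology (lcosets\<^bsub>G\<^esub> H)) (subtopology (Euclidean_space n) (disk n))"

text \<open>
  The subspace \<open>B\<close> of \<open>Y\<close> is the pushout of \<open>A\<close> and \<open>\<Squnion> G/H \<times> D\<^sup>n\<close> along \<open>G\<close>-maps
  \<open>G/H \<times> S\<^sup>n\<^sup>-\<^sup>1 \<rightarrow> A\<close>: as a set it is the disjoint union of \<open>A\<close> and the open cells, and it has the
  quotient topology.  A cell is given by \<open>H\<close> and its characteristic map \<open>\<Phi>\<close>; no separate index set is
  needed, since distinct cells have disjoint non-empty interiors.
\<close>

definition attaches_G_cells ::
    "('g, 'b) monoid_scheme \<Rightarrow> 'y topology \<Rightarrow> ('g \<Rightarrow> 'y \<Rightarrow> 'y) \<Rightarrow> nat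
      \<Rightarrow> ('g set \<times> ('g set \<times> (nat \<Rightarrow> real) \<Rightarrow> 'y)) set \<Rightarrow> 'y set \<Rightarrow> 'y set \<Rightarrow> bool" where
  "attaches_G_cells G Y \<psi> n cells A B \<longleftrightarrow>
     A \<subseteq> B \<and> B \<subseteq> topspace Y \<and>
     (\<forall>(H, \<Phi>) \<in> cells.
        subgroup H G \<and>
        continuous_map (G_cell G n H) (subtopology Y B) \<Phi> \<and>
        (\<forall>g \<in> carrier G. \<forall>C \<in> lcosets\<^bsub>G\<^esub> H. \<forall>t \<in> disk n. \<Phi> (g <#\<^bsub>G\<^esub> C, t) = \<psi> g (\<Phi> (C, t))) \<and>
        \<Phi> ` ((lcosets\<^bsub>G\<^esub> H) \<times> disk_boundary n) \<subseteq> A) \<and>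
     bij_betw (\<lambda>((H, \<Phi>), p). \<Phi> p)
       (SIGMA c:cells. (lcosets\<^bsub>G\<^esub> (fst c)) \<times> (disk n - disk_boundary n)) (B - A) \<and>
     (\<forall>W \<subseteq> B.
        closedin (subtopology Y B) W \<longleftrightarrow>
          closedin (subtopology Y A) (W \<inter> A) \<and>
          (\<forall>(H, \<Phi>) \<in> cells. closedin (G_cell G n H) {p \<in> topspace (G_cell G n H). \<Phi> p \<in> W}))"

text \<open>The index of the filtration is shifted: \<open>K (Suc n)\<close> is the \<open>n\<close>-skeleton and \<open>K 0\<close> is empty.\<close>

definition G_CW_complex ::
    "('g, 'b) monoid_scheme \<Rightarrow> 'y topology \<Rightarrow> ('g \<Rightarrow> 'y \<Rightarrow> 'y) \<Rightarrow> bool" where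
  "G_CW_complex G Y \<psi> \<longleftrightarrow>
     G_space G Y \<psi> \<and>
     (\<exists>K cells.
        K 0 = {} \<and>
        (\<forall>n. attaches_G_cells G Y \<psi> n (cells n) (K n) (K (Suc n))) \<and>
        topspace Y = (\<Union>n. K n) \<and>
        (\<forall>W \<subseteq> topspace Y.
           closedin Y W \<longleftrightarrow> (\<forall>n. closedin (subtopology Y (K n)) (W \<inter> K n))))"


section \<open>Modules\<close>

definition linear_maps ::
    "('r, 's) ring_scheme \<Rightarrow> ('r, 'm) module \<Rightarrow> ('r, 'n) module \<Rightarrow> ('m \<Rightarrow> 'n) set" where
  "linear_maps R M N =
     {f \<in> hom (add_monoid M) (add_monoid N).
        \<forall>r \<in> carrier R. \<forall>x \<in> carrier M. f (r \<odot>\<^bsub>M\<^esub> x) = r \<odot>\<^bsub>N\<^esub> f x}"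

text \<open>
  Module records extend ring records; their multiplicative fields play no role and are left
  \<^const>\<open>undefined\<close> in the modules constructed here.
\<close>

definition quotient_module :: "('r, 'm) module \<Rightarrow> 'm set \<Rightarrow> ('r, 'm set) module" where
  "quotient_module M B =
     \<lparr>carrier = a_rcosets\<^bsub>M\<^esub> B, mult = undefined, one = undefined,
      zero = B, add = set_add M,
      smult = \<lambda>r C. \<Union>c\<in>C. B +>\<^bsub>M\<^esub> (r \<odot>\<^bsub>M\<^esub> c)\<rparr>"


section \<open>Covariant coefficient systems\<close>

text \<open>Morphisms \<open>G/H \<rightarrow> G/K\<close> of the orbit category.\<close>

definition orbit_maps ::
    "('g, 'b) monoid_scheme \<Rightarrow> 'g set \<Rightarrow> 'g set \<Rightarrow> ('g set \<Rightarrow> 'g set) set" where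
  "orbit_maps G H K =
     {\<alpha> \<in> (lcosets\<^bsub>G\<^esub> H) \<rightarrow>\<^sub>E (lcosets\<^bsub>G\<^esub> K).
        \<forall>g \<in> carrier G. \<forall>C \<in> lcosets\<^bsub>G\<^esub> H. \<alpha> (g <#\<^bsub>G\<^esub> C) = g <#\<^bsub>G\<^esub> \<alpha> C}"

text \<open>
  \<open>Ob M H\<close> is the module \<open>M(G/H)\<close>, and \<open>Mor M H K \<alpha>\<close> is \<open>M\<^sub>*(\<alpha>)\<close> for \<open>\<alpha> : G/H \<rightarrow> G/K\<close>.
\<close>

record ('g, 'r, 'm) coeff =
  Ob :: "'g set \<Rightarrow> ('r, 'm) module"
  Mor :: "'g set \<Rightarrow> 'g set \<Rightarrow> ('g set \<Rightarrow> 'g set) \<Rightarrow> 'm \<Rightarrow> 'm"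

definition coefficient_system ::
    "('r, 's) ring_scheme \<Rightarrow> ('g, 'b) monoid_scheme \<Rightarrow> ('g, 'r, 'm) coeff \<Rightarrow> bool" where
  "coefficient_system R G M \<longleftrightarrow>
     (\<forall>H. subgroup H G \<longrightarrow> Module.module R (Ob M H)) \<and>
     (\<forall>H K \<alpha>. subgroup H G \<and> subgroup K G \<and> \<alpha> \<in> orbit_maps G H K \<longrightarrow>
        Mor M H K \<alpha> \<in> linear_maps R (Ob M H) (Ob M K)) \<and>
     (\<forall>H. subgroup H G \<longrightarrow>
        (\<forall>l \<in> carrier (Ob M H). Mor M H H (\<lambda>C \<in> lcosets\<^bsub>G\<^esub> H. C) l = l)) \<and>
     (\<forall>H K L \<alpha> \<beta>. subgroup H G \<and> subgroup K G \<and> subgroup L G \<and>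
        \<alpha> \<in> orbit_maps G H K \<and> \<beta> \<in> orbit_maps G K L \<longrightarrow>
        (\<forall>l \<in> carrier (Ob M H).
           Mor M H L (compose (lcosets\<^bsub>G\<^esub> H) \<beta> \<alpha>) l = Mor M K L \<beta> (Mor M H K \<alpha> l)))"

text \<open>
  The \<open>G\<close>-function \<open>G/H \<rightarrow> G/K\<close>, \<open>aH \<mapsto> abK\<close>, defined when \<open>b\<^sup>-\<^sup>1 H b \<subseteq> K\<close>; then all the cosets in
  the union coincide.
\<close>

definition orbit_map ::
    "('g, 'b) monoid_scheme \<Rightarrow> 'g set \<Rightarrow> 'g set \<Rightarrow> 'g \<Rightarrow> 'g set \<Rightarrow> 'g set" where
  "orbit_map G H K b = (\<lambda>C \<in> lcosets\<^bsub>G\<^esub> H. \<Union>a\<in>C. (a \<otimes>\<^bsub>G\<^esub> b) <#\<^bsub>G\<^esub> K)"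


section \<open>The functor \<open>F\<^sup>G(-, M)\<close> on pointed \<open>G\<close>-sets\<close>

record ('g, 's) gset =
  elems :: "'s set"
  act :: "'g \<Rightarrow> 's \<Rightarrow> 's"
  base :: 's

abbreviation isotropy :: "('g, 'b) monoid_scheme \<Rightarrow> ('g, 's) gset \<Rightarrow> 's \<Rightarrow> 'g set" where
  "isotropy G S x \<equiv> stabilizer G (act S) x"

definition F_mod ::
    "('g, 'b) monoid_scheme \<Rightarrow> ('g, 'r, 'm) coeff \<Rightarrow> ('g, 's) gset \<Rightarrow> ('r, 's \<Rightarrow> 'm) module" where
  "F_mod G M S =
     \<lparr>carrier = {u \<in> (\<Pi>\<^sub>E x\<in>elems S. carrier (Ob M (isotropy G S x))).
                   u (base S) = \<zero>\<^bsub>Ob M (isotropy G S (base S))\<^esub> \<and>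
                   finite {x \<in> elems S. u x \<noteq> \<zero>\<^bsub>Ob M (isotropy G S x)\<^esub>}},
      mult = undefined, one = undefined,
      zero = (\<lambda>x\<in>elems S. \<zero>\<^bsub>Ob M (isotropy G S x)\<^esub>),
      add = (\<lambda>u v. \<lambda>x\<in>elems S. u x \<oplus>\<^bsub>Ob M (isotropy G S x)\<^esub> v x),
      smult = (\<lambda>r u. \<lambda>x\<in>elems S. r \<odot>\<^bsub>Ob M (isotropy G S x)\<^esub> u x)\<rparr>"

text \<open>The element \<open>lx\<close>.\<close>

definition F_single ::
    "('g, 'b) monoid_scheme \<Rightarrow> ('g, 'r, 'm) coeff \<Rightarrow> ('g, 's) gset \<Rightarrow> 'm \<Rightarrow> 's \<Rightarrow> 's \<Rightarrow> 'm" where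
  "F_single G M S l x =
     (\<lambda>y\<in>elems S. if y = x \<and> x \<noteq> base S then l else \<zero>\<^bsub>Ob M (isotropy G S y)\<^esub>)"

text \<open>\<open>M\<^sub>*(R\<^bsub>g\<^sup>-\<^sup>1\<^esub>) : M(G/G\<^sub>x) \<rightarrow> M(G/G\<^bsub>gx\<^esub>)\<close>.\<close>

definition transl ::
    "('g, 'b) monoid_scheme \<Rightarrow> ('g, 'r, 'm) coeff \<Rightarrow> ('g, 's) gset \<Rightarrow> 'g \<Rightarrow> 's \<Rightarrow> 'm \<Rightarrow> 'm" where
  "transl G M S g x =
     Mor M (isotropy G S x) (isotropy G S (act S g x))
       (orbit_map G (isotropy G S x) (isotropy G S (act S g x)) (inv\<^bsub>G\<^esub> g))"

text \<open>The additive extension of \<open>g \<cdot> (lx) = M\<^sub>*(R\<^bsub>g\<^sup>-\<^sup>1\<^esub>)(l)(gx)\<close>, evaluated at \<open>y = gx\<close>.\<close>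

definition F_act ::
    "('g, 'b) monoid_scheme \<Rightarrow> ('g, 'r, 'm) coeff \<Rightarrow> ('g, 's) gset \<Rightarrow> 'g \<Rightarrow> ('s \<Rightarrow> 'm) \<Rightarrow> 's \<Rightarrow> 'm"
  where
  "F_act G M S g u =
     (\<lambda>y\<in>elems S. let x = act S (inv\<^bsub>G\<^esub> g) y in transl G M S g x (u x))"

definition FG_mod ::
    "('g, 'b) monoid_scheme \<Rightarrow> ('g, 'r, 'm) coeff \<Rightarrow> ('g, 's) gset \<Rightarrow> ('r, 's \<Rightarrow> 'm) module" where
  "FG_mod G M S =
     (F_mod G M S)\<lparr>carrier := {u \<in> carrier (F_mod G M S). \<forall>g \<in> carrier G. F_act G M S g u = u}\<rparr>"

text \<open>\<open>\<gamma>\<^sup>G\<^sub>x(l)\<close>; the summand does not depend on the representative chosen in each coset.\<close>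

definition gamma ::
    "('g, 'b) monoid_scheme \<Rightarrow> ('g, 'r, 'm) coeff \<Rightarrow> ('g, 's) gset \<Rightarrow> 's \<Rightarrow> 'm \<Rightarrow> 's \<Rightarrow> 'm" where
  "gamma G M S x l =
     (\<Oplus>\<^bsub>F_mod G M S\<^esub> C \<in> lcosets\<^bsub>G\<^esub> (isotropy G S x).
        let g = (SOME g. g \<in> C) in F_single G M S (transl G M S g x l) (act S g x))"

text \<open>
  \<open>f\<^sup>G\<^sub>* : F\<^sup>G(S,M) \<rightarrow> F\<^sup>G(T,M)\<close> for a pointed \<open>G\<close>-function \<open>f\<close>: the homomorphism (made unique as a HOL
  function by extensionality) with the prescribed values on the generators \<open>\<gamma>\<^sup>G\<^sub>x(l)\<close>.  The canonical
  projection \<open>G/G\<^sub>x \<rightarrow> G/G\<^bsub>f(x)\<^esub>\<close> is \<^const>\<open>orbit_map\<close> at the unit of \<open>G\<close>.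
\<close>

definition FG_map ::
    "('r, 'c) ring_scheme \<Rightarrow> ('g, 'b) monoid_scheme \<Rightarrow> ('g, 'r, 'm) coeff
      \<Rightarrow> ('g, 's) gset \<Rightarrow> ('g, 't) gset \<Rightarrow> ('s \<Rightarrow> 't) \<Rightarrow> ('s \<Rightarrow> 'm) \<Rightarrow> ('t \<Rightarrow> 'm)" where
  "FG_map R G M S T f =
     (THE h. h \<in> linear_maps R (FG_mod G M S) (FG_mod G M T) \<and>
             h \<in> extensional (carrier (FG_mod G M S)) \<and>
             (\<forall>x \<in> elems S. \<forall>l \<in> carrier (Ob M (isotropy G S x)).
                h (gamma G M S x l) =
                gamma G M T (f x)
                  (Mor M (isotropy G S x) (isotropy G T (f x))
                     (orbit_map G (isotropy G S x) (isotropy G T (f x)) \<one>\<^bsub>G\<^esub>) l)))"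


section \<open>Reduced Bredon-Illman homology\<close>

definition singular_gset ::
    "'x topology \<Rightarrow> ('g \<Rightarrow> 'x \<Rightarrow> 'x) \<Rightarrow> 'x \<Rightarrow> nat \<Rightarrow> ('g, (nat \<Rightarrow> real) \<Rightarrow> 'x) gset" where
  "singular_gset X \<phi> x0 q =
     \<lparr>elems = singular_simplex_set q X,
      act = (\<lambda>g. \<lambda>\<sigma> \<in> singular_simplex_set q X. simplex_map q (\<phi> g) \<sigma>),
      base = (\<lambda>t \<in> standard_simplex q. x0)\<rparr>"

definition bredon_chain ::
    "('g, 'b) monoid_scheme \<Rightarrow> ('g, 'r, 'm) coeff \<Rightarrow> 'x topology \<Rightarrow> ('g \<Rightarrow> 'x \<Rightarrow> 'x) \<Rightarrow> 'x \<Rightarrow> nat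
      \<Rightarrow> ('r, ((nat \<Rightarrow> real) \<Rightarrow> 'x) \<Rightarrow> 'm) module" where
  "bredon_chain G M X \<phi> x0 q = FG_mod G M (singular_gset X \<phi> x0 q)"

text \<open>
  The differential from degree \<open>q\<close> to degree \<open>q - 1\<close>.  As for \<^const>\<open>chain_boundary\<close>, it is zero for
  \<open>q = 0\<close> (formally with target the chains of degree 0).
\<close>

definition bredon_differential ::
    "('r, 'c) ring_scheme \<Rightarrow> ('g, 'b) monoid_scheme \<Rightarrow> ('g, 'r, 'm) coeff
      \<Rightarrow> 'x topology \<Rightarrow> ('g \<Rightarrow> 'x \<Rightarrow> 'x) \<Rightarrow> 'x \<Rightarrow> nat
      \<Rightarrow> (((nat \<Rightarrow> real) \<Rightarrow> 'x) \<Rightarrow> 'm) \<Rightarrow> (((nat \<Rightarrow> real) \<Rightarrow> 'x) \<Rightarrow> 'm)" where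
  "bredon_differential R G M X \<phi> x0 q u =
     (let C = bredon_chain G M X \<phi> x0 (q - 1) in
      if q = 0 then \<zero>\<^bsub>C\<^esub>
      else (\<Oplus>\<^bsub>C\<^esub> i \<in> {..q}.
              ((\<ominus>\<^bsub>R\<^esub> \<one>\<^bsub>R\<^esub>) [^]\<^bsub>R\<^esub> i) \<odot>\<^bsub>C\<^esub>
              FG_map R G M (singular_gset X \<phi> x0 q) (singular_gset X \<phi> x0 (q - 1))
                (singular_face q i) u))"

definition bredon_homology ::
    "('r, 'c) ring_scheme \<Rightarrow> ('g, 'b) monoid_scheme \<Rightarrow> ('g, 'r, 'm) coeff
      \<Rightarrow> 'x topology \<Rightarrow> ('g \<Rightarrow> 'x \<Rightarrow> 'x) \<Rightarrow> 'x \<Rightarrow> nat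
      \<Rightarrow> ('r, (((nat \<Rightarrow> real) \<Rightarrow> 'x) \<Rightarrow> 'm) set) module" where
  "bredon_homology R G M X \<phi> x0 q =
     quotient_module
       ((bredon_chain G M X \<phi> x0 q)
          \<lparr>carrier := a_kernel (bredon_chain G M X \<phi> x0 q) (bredon_chain G M X \<phi> x0 (q - 1))
                         (bredon_differential R G M X \<phi> x0 q)\<rparr>)
       (bredon_differential R G M X \<phi> x0 (Suc q) ` carrier (bredon_chain G M X \<phi> x0 (Suc q)))"

end

theory Submission
  imports Defs
begin

text \<open>
  A degree 0 chain is a sum of elements \<open>\<gamma>\<^sup>G\<^sub>x(l)\<close> with \<open>x\<close> a point of \<open>X\<close>.  With \<open>H = G\<^sub>x\<close>, a path \<open>\<sigma>\<close> in
  \<open>X\<^sup>H\<close> from the base point to \<open>x\<close> has isotropy group exactly \<open>H\<close>, so \<open>\<gamma>\<^sup>G\<^sub>\<sigma>(l)\<close> is a 1-chain with boundary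
  \<open>\<gamma>\<^sup>G\<^sub>x(l)\<close>, the other end contributing zero.  Such a path exists because in a \<open>G\<close>-CW-complex \<open>Y\<close> every
  union of path components of \<open>Y\<^sup>H\<close> is closed, by induction over the skeleta; hence the connected image
  of \<open>X\<^sup>H\<close> in \<open>Y\<^sup>H\<close> lies in one path component, and the homotopy inverse carries paths back to \<open>X\<^sup>H\<close>.
\<close>

section \<open>Homomorphisms induced by maps of orbits\<close>

text \<open>The path has to lie in the fixed point space because a 1-simplex with smaller isotropy
  group K carries coefficients in M(G/K), and M(G/K) -> M(G/H) need not hit l. Inside the fixed
  points of H the isotropy contains H; since passing to a face can only enlarge isotropy, the face x
  bounds it above by H. So l itself is a coefficient for the path and nothing has to be lifted.

  \<open>FG_map\<close> is a definite description through values on generators, so no boundary can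
  be computed before existence and uniqueness of that homomorphism are known. This dictates the
  algebra: uniqueness comes from decomposing invariant functions into generators, one for each
  orbit, and existence from an explicit formula on orbit representatives.

  The topology works with closed sets because a G-CW-complex comes with a test for closedness on
  cells. The complement in \<open>fixed_points Y \<psi> H\<close> of a union of path components is
  again such a union, so both sides are closed and no neighbourhoods have to be built.\<close>

locale finite_coefficient_system = group G + R: cring R
  for G :: "('g, 'b) monoid_scheme" and R :: "('r, 'c) ring_scheme" +
  fixes M :: "('g, 'r, 'm) coeff"
  assumes finite_group: "finite (carrier G)"
    and coefficients: "coefficient_system R G M"
begin

lemma module_Ob: "subgroup H G \<Longrightarrow> Module.module R (Ob M H)"
  using coefficients unfolding coefficient_system_def by blast

lemma abelian_group_Ob: "subgroup H G \<Longrightarrow> abelian_group (Ob M H)"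
  using module_Ob Module.module.axioms(2) by blast

lemma Mor_linear:
  assumes "subgroup H G" "subgroup K G" "\<alpha> \<in> orbit_maps G H K"
  shows "Mor M H K \<alpha> \<in> linear_maps R (Ob M H) (Ob M K)"
  using coefficients assms by (simp add: coefficient_system_def)

lemma Mor_id:
  assumes "subgroup H G" "l \<in> carrier (Ob M H)"
  shows "Mor M H H (\<lambda>C \<in> lcosets\<^bsub>G\<^esub> H. C) l = l"
  using coefficients assms by (simp add: coefficient_system_def)

lemma Mor_compose:
  assumes "subgroup H G" "subgroup K G" "subgroup L G"
    and "\<alpha> \<in> orbit_maps G H K" "\<beta> \<in> orbit_maps G K L" "l \<in> carrier (Ob M H)"
  shows "Mor M H L (compose (lcosets\<^bsub>G\<^esub> H) \<beta> \<alpha>) l = Mor M K L \<beta> (Mor M H K \<alpha> l)"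
  using coefficients assms by (simp add: coefficient_system_def)

section \<open>Maps of orbits labelled by group elements\<close>

definition orbit_admissible :: "'g set \<Rightarrow> 'g set \<Rightarrow> 'g \<Rightarrow> bool" where
  "orbit_admissible H K b \<longleftrightarrow>
     subgroup H G \<and> subgroup K G \<and> b \<in> carrier G \<and> (\<forall>h\<in>H. inv\<^bsub>G\<^esub> b \<otimes>\<^bsub>G\<^esub> h \<otimes>\<^bsub>G\<^esub> b \<in> K)"

text \<open>Translations (label \<open>inv g\<close>) and canonical projections (label
  \<open>\<one>\<close>) are both of this form, so their composition laws reduce to multiplication
  of labels.\<close>

definition orbit_hom :: "'g set \<Rightarrow> 'g set \<Rightarrow> 'g \<Rightarrow> 'm \<Rightarrow> 'm" where
  "orbit_hom H K b = Mor M H K (orbit_map G H K b)"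

lemma inv_mult_cancel [simp]:
  assumes "a \<in> carrier G" "x \<in> carrier G"
  shows "inv\<^bsub>G\<^esub> a \<otimes>\<^bsub>G\<^esub> (a \<otimes>\<^bsub>G\<^esub> x) = x" "a \<otimes>\<^bsub>G\<^esub> (inv\<^bsub>G\<^esub> a \<otimes>\<^bsub>G\<^esub> x) = x"
  using assms by (simp_all add: m_assoc[symmetric])

lemma l_coset_eq_iff:
  assumes "subgroup K G" "a \<in> carrier G" "b \<in> carrier G"
  shows "a <#\<^bsub>G\<^esub> K = b <#\<^bsub>G\<^esub> K \<longleftrightarrow> inv\<^bsub>G\<^esub> a \<otimes>\<^bsub>G\<^esub> b \<in> K"
proof
  assume "a <#\<^bsub>G\<^esub> K = b <#\<^bsub>G\<^esub> K"
  then have "b \<in> a <#\<^bsub>G\<^esub> K"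
    using lcos_self assms by blast
  then show "inv\<^bsub>G\<^esub> a \<otimes>\<^bsub>G\<^esub> b \<in> K"
    using subgroup.lcos_module_imp[OF assms(1) is_group] assms by blast
next
  assume "inv\<^bsub>G\<^esub> a \<otimes>\<^bsub>G\<^esub> b \<in> K"
  then have "b \<in> a <#\<^bsub>G\<^esub> K"
    using subgroup.lcos_module_rev[OF assms(1) is_group] assms by blast
  then show "a <#\<^bsub>G\<^esub> K = b <#\<^bsub>G\<^esub> K"
    using l_repr_independence assms by blast
qed

lemma l_coset_mem_lcosets: "a \<in> carrier G \<Longrightarrow> a <#\<^bsub>G\<^esub> H \<in> lcosets\<^bsub>G\<^esub> H"
  by (auto simp: LCOSETS_def)

lemma lcosetsE:
  assumes "C \<in> lcosets\<^bsub>G\<^esub> H"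
  obtains a where "a \<in> carrier G" "C = a <#\<^bsub>G\<^esub> H"
  using assms by (auto simp: LCOSETS_def)

lemma finite_lcosets: "finite (lcosets\<^bsub>G\<^esub> H)"
  unfolding LCOSETS_def using finite_group by auto

text \<open>Elements of \<open>a H\<close> differ by some h in H, and the conjugate of h by b lies
  in K and is absorbed there. Hence all cosets in the union defining \<open>orbit_map\<close>
  coincide.\<close>

lemma orbit_map_l_coset:
  assumes adm: "orbit_admissible H K b" and a: "a \<in> carrier G"
  shows "orbit_map G H K b (a <#\<^bsub>G\<^esub> H) = (a \<otimes>\<^bsub>G\<^esub> b) <#\<^bsub>G\<^esub> K"
proof -
  have H: "subgroup H G" and K: "subgroup K G" and b: "b \<in> carrier G"
    and conj: "\<And>h. h \<in> H \<Longrightarrow> inv\<^bsub>G\<^esub> b \<otimes>\<^bsub>G\<^esub> h \<otimes>\<^bsub>G\<^esub> b \<in> K"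
    using adm by (auto simp: orbit_admissible_def)
  have "(c \<otimes>\<^bsub>G\<^esub> b) <#\<^bsub>G\<^esub> K = (a \<otimes>\<^bsub>G\<^esub> b) <#\<^bsub>G\<^esub> K" if "c \<in> a <#\<^bsub>G\<^esub> H" for c
  proof -
    from that obtain h where h: "h \<in> H" "c = a \<otimes>\<^bsub>G\<^esub> h"
      by (auto simp: l_coset_def)
    have hG: "h \<in> carrier G"
      using subgroup.mem_carrier[OF H h(1)] .
    have "inv\<^bsub>G\<^esub> (a \<otimes>\<^bsub>G\<^esub> b) \<otimes>\<^bsub>G\<^esub> (c \<otimes>\<^bsub>G\<^esub> b) = inv\<^bsub>G\<^esub> b \<otimes>\<^bsub>G\<^esub> h \<otimes>\<^bsub>G\<^esub> b"
      using a b hG h(2) by (simp add: inv_mult_group m_assoc)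
    then have "inv\<^bsub>G\<^esub> (a \<otimes>\<^bsub>G\<^esub> b) \<otimes>\<^bsub>G\<^esub> (c \<otimes>\<^bsub>G\<^esub> b) \<in> K"
      using conj h by simp
    then show ?thesis
      using l_coset_eq_iff[OF K, of "a \<otimes>\<^bsub>G\<^esub> b" "c \<otimes>\<^bsub>G\<^esub> b"] a b hG h(2) by simp
  qed
  moreover have "a \<in> a <#\<^bsub>G\<^esub> H"
    using lcos_self a H by blast
  ultimately have "(\<Union>c\<in>a <#\<^bsub>G\<^esub> H. (c \<otimes>\<^bsub>G\<^esub> b) <#\<^bsub>G\<^esub> K) = (a \<otimes>\<^bsub>G\<^esub> b) <#\<^bsub>G\<^esub> K"
    by blast
  then show ?thesis
    by (simp add: orbit_map_def l_coset_mem_lcosets a)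
qed

lemma orbit_map_mem:
  assumes adm: "orbit_admissible H K b"
  shows "orbit_map G H K b \<in> orbit_maps G H K"
proof -
  have b: "b \<in> carrier G" and H: "subgroup H G" and K: "subgroup K G"
    using adm by (auto simp: orbit_admissible_def)
  have sub: "H \<subseteq> carrier G" "K \<subseteq> carrier G"
    using H K subgroup.subset by blast+
  have "orbit_map G H K b C \<in> lcosets\<^bsub>G\<^esub> K" if "C \<in> lcosets\<^bsub>G\<^esub> H" for C
    using that by (elim lcosetsE) (simp add: orbit_map_l_coset[OF adm] l_coset_mem_lcosets b)
  moreover have "orbit_map G H K b (g <#\<^bsub>G\<^esub> C) = g <#\<^bsub>G\<^esub> orbit_map G H K b C"
    if "C \<in> lcosets\<^bsub>G\<^esub> H" "g \<in> carrier G" for g C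
    using that
    by (elim lcosetsE)
      (simp add: orbit_map_l_coset[OF adm] lcos_m_assoc sub b m_assoc)
  ultimately show ?thesis
    by (auto simp: orbit_maps_def orbit_map_def)
qed

lemma orbit_hom_linear:
  "orbit_admissible H K b \<Longrightarrow> orbit_hom H K b \<in> linear_maps R (Ob M H) (Ob M K)"
  unfolding orbit_hom_def by (rule Mor_linear) (simp_all add: orbit_map_mem, simp_all add: orbit_admissible_def)

lemma orbit_hom_closed:
  "orbit_admissible H K b \<Longrightarrow> l \<in> carrier (Ob M H) \<Longrightarrow> orbit_hom H K b l \<in> carrier (Ob M K)"
  using orbit_hom_linear[of H K b] by (auto simp: linear_maps_def hom_def)

lemma orbit_hom_add:
  "orbit_admissible H K b \<Longrightarrow> l \<in> carrier (Ob M H) \<Longrightarrow> l' \<in> carrier (Ob M H) \<Longrightarrow>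
     orbit_hom H K b (l \<oplus>\<^bsub>Ob M H\<^esub> l') = orbit_hom H K b l \<oplus>\<^bsub>Ob M K\<^esub> orbit_hom H K b l'"
  using orbit_hom_linear[of H K b] by (auto simp: linear_maps_def hom_def)

lemma orbit_hom_smult:
  "orbit_admissible H K b \<Longrightarrow> r \<in> carrier R \<Longrightarrow> l \<in> carrier (Ob M H) \<Longrightarrow>
     orbit_hom H K b (r \<odot>\<^bsub>Ob M H\<^esub> l) = r \<odot>\<^bsub>Ob M K\<^esub> orbit_hom H K b l"
  using orbit_hom_linear[of H K b] by (auto simp: linear_maps_def)

lemma orbit_hom_zero:
  assumes "orbit_admissible H K b"
  shows "orbit_hom H K b \<zero>\<^bsub>Ob M H\<^esub> = \<zero>\<^bsub>Ob M K\<^esub>"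
proof -
  interpret H: abelian_group "Ob M H"
    using assms abelian_group_Ob orbit_admissible_def by blast
  interpret K: abelian_group "Ob M K"
    using assms abelian_group_Ob orbit_admissible_def by blast
  \<comment> \<open>An element z of a group with z + z = z is zero.\<close>
  have "orbit_hom H K b \<zero>\<^bsub>Ob M H\<^esub> \<oplus>\<^bsub>Ob M K\<^esub> orbit_hom H K b \<zero>\<^bsub>Ob M H\<^esub>
      = orbit_hom H K b \<zero>\<^bsub>Ob M H\<^esub>"
    using orbit_hom_add[OF assms H.zero_closed H.zero_closed] by simp
  then show ?thesis
    using orbit_hom_closed[OF assms H.zero_closed] K.add.r_cancel_one by blast
qed

text \<open>Labels multiply under composition. A label matters only through its coset modulo the
  target subgroup, so d is compared with \<open>b c\<close> modulo L.\<close>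

lemma orbit_hom_comp:
  assumes 1: "orbit_admissible H K b" and 2: "orbit_admissible K L c"
    and 3: "orbit_admissible H L d" and d: "inv\<^bsub>G\<^esub> (b \<otimes>\<^bsub>G\<^esub> c) \<otimes>\<^bsub>G\<^esub> d \<in> L"
    and l: "l \<in> carrier (Ob M H)"
  shows "orbit_hom K L c (orbit_hom H K b l) = orbit_hom H L d l"
proof -
  have sub: "subgroup H G" "subgroup K G" "subgroup L G" "b \<in> carrier G" "c \<in> carrier G" "d \<in> carrier G"
    using 1 2 3 by (auto simp: orbit_admissible_def)
  have coset: "(a \<otimes>\<^bsub>G\<^esub> b \<otimes>\<^bsub>G\<^esub> c) <#\<^bsub>G\<^esub> L = (a \<otimes>\<^bsub>G\<^esub> d) <#\<^bsub>G\<^esub> L" if a: "a \<in> carrier G" for a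
  proof -
    have "(b \<otimes>\<^bsub>G\<^esub> c) <#\<^bsub>G\<^esub> L = d <#\<^bsub>G\<^esub> L"
      using l_coset_eq_iff[OF sub(3), of "b \<otimes>\<^bsub>G\<^esub> c" d] sub d by simp
    then have "a <#\<^bsub>G\<^esub> ((b \<otimes>\<^bsub>G\<^esub> c) <#\<^bsub>G\<^esub> L) = a <#\<^bsub>G\<^esub> (d <#\<^bsub>G\<^esub> L)"
      by simp
    then show ?thesis
      using a sub lcos_m_assoc[OF subgroup.subset[OF sub(3)]] by (simp add: m_assoc)
  qed
  have "compose (lcosets\<^bsub>G\<^esub> H) (orbit_map G K L c) (orbit_map G H K b) = orbit_map G H L d"
  proof (rule extensionalityI[of _ "lcosets\<^bsub>G\<^esub> H"])
    show "orbit_map G H L d \<in> extensional (lcosets\<^bsub>G\<^esub> H)"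
      by (simp add: orbit_map_def)
  next
    fix C assume "C \<in> lcosets\<^bsub>G\<^esub> H"
    then obtain a where "a \<in> carrier G" "C = a <#\<^bsub>G\<^esub> H"
      by (elim lcosetsE)
    then show "compose (lcosets\<^bsub>G\<^esub> H) (orbit_map G K L c) (orbit_map G H K b) C = orbit_map G H L d C"
      by (simp add: compose_eq l_coset_mem_lcosets orbit_map_l_coset[OF 1] orbit_map_l_coset[OF 2]
          orbit_map_l_coset[OF 3] sub coset)
  qed simp
  then show ?thesis
    using Mor_compose[OF sub(1-3) orbit_map_mem[OF 1] orbit_map_mem[OF 2] l]
    by (simp add: orbit_hom_def)
qed

text \<open>Right multiplication by an element of H fixes every coset of H, so the orbit map is the
  identity. Triviality of translation by isotropy elements and of projections between equal isotropy
  groups both come from here.\<close>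

lemma orbit_hom_id:
  assumes H: "subgroup H G" and b: "b \<in> H" and l: "l \<in> carrier (Ob M H)"
  shows "orbit_hom H H b l = l"
proof -
  have bG: "b \<in> carrier G"
    using subgroup.mem_carrier[OF H b] .
  have adm: "orbit_admissible H H b"
    unfolding orbit_admissible_def using H b bG
    by (simp add: subgroup.m_closed subgroup.m_inv_closed)
  have "orbit_map G H H b = (\<lambda>C \<in> lcosets\<^bsub>G\<^esub> H. C)"
  proof (rule extensionalityI[of _ "lcosets\<^bsub>G\<^esub> H"])
    show "orbit_map G H H b \<in> extensional (lcosets\<^bsub>G\<^esub> H)"
      by (simp add: orbit_map_def)
  next
    fix C assume "C \<in> lcosets\<^bsub>G\<^esub> H"
    then obtain a where a: "a \<in> carrier G" "C = a <#\<^bsub>G\<^esub> H"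
      by (elim lcosetsE)
    have "a <#\<^bsub>G\<^esub> H = (a \<otimes>\<^bsub>G\<^esub> b) <#\<^bsub>G\<^esub> H"
      using l_coset_eq_iff[OF H, of a "a \<otimes>\<^bsub>G\<^esub> b"] a b bG by simp
    then show "orbit_map G H H b C = (\<lambda>C \<in> lcosets\<^bsub>G\<^esub> H. C) C"
      using orbit_map_l_coset[OF adm a(1)] a(2) \<open>C \<in> lcosets\<^bsub>G\<^esub> H\<close> by simp
  qed simp
  then show ?thesis
    using Mor_id[OF H l] by (simp add: orbit_hom_def)
qed

end

section \<open>The modules \<open>F(S, M)\<close> and \<open>F\<^sup>G(S, M)\<close>\<close>

text \<open>For infinite I both sums take the default value zero, so finiteness is not assumed.
  \<open>h0\<close> settles that case and the empty one; for monoids it does not follow from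
  additivity.\<close>

lemma finsum_hom:
  assumes A: "abelian_monoid A" and B: "abelian_monoid B"
    and h: "h \<in> hom (add_monoid A) (add_monoid B)" and h0: "h \<zero>\<^bsub>A\<^esub> = \<zero>\<^bsub>B\<^esub>"
    and f: "f \<in> I \<rightarrow> carrier A"
  shows "h (finsum A f I) = finsum B (\<lambda>i. h (f i)) I"
proof -
  interpret A: abelian_monoid A by (rule A)
  interpret B: abelian_monoid B by (rule B)
  have hcl: "h a \<in> carrier B" if "a \<in> carrier A" for a
    using h that by (auto simp: hom_def)
  have hadd: "h (a \<oplus>\<^bsub>A\<^esub> b) = h a \<oplus>\<^bsub>B\<^esub> h b" if "a \<in> carrier A" "b \<in> carrier A" for a b
    using h that by (auto simp: hom_def)
  show ?thesis
    using f
  proof (induction I rule: infinite_finite_induct)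
    case (insert i I)
    then have "f i \<in> carrier A" "f \<in> I \<rightarrow> carrier A"
      by auto
    moreover from this have "(\<lambda>i. h (f i)) \<in> I \<rightarrow> carrier B" "h (f i) \<in> carrier B"
      using hcl by auto
    ultimately show ?case
      using insert by (simp add: A.finsum_insert B.finsum_insert hadd A.finsum_closed)
  qed (simp_all add: h0)
qed

locale coefficient_gset = finite_coefficient_system G R M
  for G :: "('g, 'b) monoid_scheme" and R :: "('r, 'c) ring_scheme" and M :: "('g, 'r, 'm) coeff" +
  fixes S :: "('g, 's) gset"
  assumes action: "group_action G (elems S) (act S)"
    and base_mem: "base S \<in> elems S"
    and base_fixed: "g \<in> carrier G \<Longrightarrow> act S g (base S) = base S"
begin

lemma act_closed: "g \<in> carrier G \<Longrightarrow> x \<in> elems S \<Longrightarrow> act S g x \<in> elems S"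
  using group_action.element_image[OF action] by blast

lemma act_mult:
  "x \<in> elems S \<Longrightarrow> g \<in> carrier G \<Longrightarrow> h \<in> carrier G \<Longrightarrow>
     act S (g \<otimes>\<^bsub>G\<^esub> h) x = act S g (act S h x)"
  using group_action.composition_rule[OF action] by blast

lemma act_one: "x \<in> elems S \<Longrightarrow> act S \<one>\<^bsub>G\<^esub> x = x"
  using group_action.id_eq_one[OF action] by (metis restrict_apply')

lemma act_inv_act:
  "x \<in> elems S \<Longrightarrow> g \<in> carrier G \<Longrightarrow> act S (inv\<^bsub>G\<^esub> g) (act S g x) = x"
  "x \<in> elems S \<Longrightarrow> g \<in> carrier G \<Longrightarrow> act S g (act S (inv\<^bsub>G\<^esub> g) x) = x"
  by (simp_all add: act_mult[symmetric] act_one)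

lemma mem_isotropy: "g \<in> isotropy G S x \<longleftrightarrow> g \<in> carrier G \<and> act S g x = x"
  by (simp add: stabilizer_def)

lemma subgroup_isotropy: "x \<in> elems S \<Longrightarrow> subgroup (isotropy G S x) G"
  using group_action.stabilizer_subgroup[OF action] by blast

lemma module_at: "x \<in> elems S \<Longrightarrow> Module.module R (Ob M (isotropy G S x))"
  by (simp add: module_Ob subgroup_isotropy)

lemma abelian_group_at: "x \<in> elems S \<Longrightarrow> abelian_group (Ob M (isotropy G S x))"
  by (simp add: abelian_group_Ob subgroup_isotropy)

section \<open>Translation of coefficients along an orbit\<close>

lemma transl_eq_orbit_hom:
  "transl G M S g x = orbit_hom (isotropy G S x) (isotropy G S (act S g x)) (inv\<^bsub>G\<^esub> g)"
  by (simp add: transl_def orbit_hom_def)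

lemma transl_admissible:
  assumes "x \<in> elems S" "g \<in> carrier G"
  shows "orbit_admissible (isotropy G S x) (isotropy G S (act S g x)) (inv\<^bsub>G\<^esub> g)"
  unfolding orbit_admissible_def
  using assms by (simp add: subgroup_isotropy act_closed mem_isotropy act_mult act_inv_act)

lemma transl_closed:
  "x \<in> elems S \<Longrightarrow> g \<in> carrier G \<Longrightarrow> l \<in> carrier (Ob M (isotropy G S x)) \<Longrightarrow>
     transl G M S g x l \<in> carrier (Ob M (isotropy G S (act S g x)))"
  by (simp add: transl_eq_orbit_hom orbit_hom_closed transl_admissible)

lemma transl_add:
  "x \<in> elems S \<Longrightarrow> g \<in> carrier G \<Longrightarrow> l \<in> carrier (Ob M (isotropy G S x)) \<Longrightarrow>
   l' \<in> carrier (Ob M (isotropy G S x)) \<Longrightarrow>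
     transl G M S g x (l \<oplus>\<^bsub>Ob M (isotropy G S x)\<^esub> l') =
     transl G M S g x l \<oplus>\<^bsub>Ob M (isotropy G S (act S g x))\<^esub> transl G M S g x l'"
  by (simp add: transl_eq_orbit_hom orbit_hom_add transl_admissible)

lemma transl_smult:
  "x \<in> elems S \<Longrightarrow> g \<in> carrier G \<Longrightarrow> r \<in> carrier R \<Longrightarrow> l \<in> carrier (Ob M (isotropy G S x)) \<Longrightarrow>
     transl G M S g x (r \<odot>\<^bsub>Ob M (isotropy G S x)\<^esub> l) =
     r \<odot>\<^bsub>Ob M (isotropy G S (act S g x))\<^esub> transl G M S g x l"
  by (simp add: transl_eq_orbit_hom orbit_hom_smult transl_admissible)

lemma transl_zero:
  "x \<in> elems S \<Longrightarrow> g \<in> carrier G \<Longrightarrow>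
     transl G M S g x \<zero>\<^bsub>Ob M (isotropy G S x)\<^esub> = \<zero>\<^bsub>Ob M (isotropy G S (act S g x))\<^esub>"
  by (simp add: transl_eq_orbit_hom orbit_hom_zero transl_admissible)

text \<open>The labels \<open>inv h\<close> and \<open>inv g\<close> multiply to
  \<open>inv (g h)\<close>; the reversal of order by inversion makes translation a left
  action.\<close>

lemma transl_transl:
  assumes x: "x \<in> elems S" and g: "g \<in> carrier G" and h: "h \<in> carrier G"
    and l: "l \<in> carrier (Ob M (isotropy G S x))"
  shows "transl G M S g (act S h x) (transl G M S h x l) = transl G M S (g \<otimes>\<^bsub>G\<^esub> h) x l"
proof -
  have "inv\<^bsub>G\<^esub> (inv\<^bsub>G\<^esub> h \<otimes>\<^bsub>G\<^esub> inv\<^bsub>G\<^esub> g) \<otimes>\<^bsub>G\<^esub> inv\<^bsub>G\<^esub> (g \<otimes>\<^bsub>G\<^esub> h) = \<one>\<^bsub>G\<^esub>"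
    using g h by (simp add: inv_mult_group m_assoc)
  moreover have "act S g (act S h x) \<in> elems S"
    using x g h by (simp add: act_closed)
  ultimately show ?thesis
    using orbit_hom_comp[OF transl_admissible[OF x h] transl_admissible[of "act S h x" g]
        transl_admissible[OF x, of "g \<otimes>\<^bsub>G\<^esub> h", unfolded act_mult[OF x g h]] _ l] x g h
    by (simp add: transl_eq_orbit_hom act_mult act_closed mem_isotropy act_one)
qed

lemma transl_isotropy:
  assumes "x \<in> elems S" "g \<in> isotropy G S x" "l \<in> carrier (Ob M (isotropy G S x))"
  shows "transl G M S g x l = l"
proof -
  have "act S g x = x" "inv\<^bsub>G\<^esub> g \<in> isotropy G S x"
    using assms subgroup.m_inv_closed[OF subgroup_isotropy] by (simp_all add: mem_isotropy)
  then show ?thesis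
    using orbit_hom_id[OF subgroup_isotropy] assms by (simp add: transl_eq_orbit_hom)
qed

text \<open>Write g = h k with k in the isotropy group of x; translation by k is trivial. This makes
  the summands of \<open>gamma\<close> independent of the representatives picked by
  \<open>SOME\<close>.\<close>

lemma transl_cong:
  assumes x: "x \<in> elems S" and g: "g \<in> carrier G" and h: "h \<in> carrier G"
    and eq: "act S g x = act S h x" and l: "l \<in> carrier (Ob M (isotropy G S x))"
  shows "transl G M S g x l = transl G M S h x l"
proof -
  have k: "inv\<^bsub>G\<^esub> h \<otimes>\<^bsub>G\<^esub> g \<in> isotropy G S x"
    using x g h eq by (simp add: mem_isotropy act_mult act_inv_act)
  then have "act S (inv\<^bsub>G\<^esub> h \<otimes>\<^bsub>G\<^esub> g) x = x"
    by (simp add: mem_isotropy)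
  then have "transl G M S h x (transl G M S (inv\<^bsub>G\<^esub> h \<otimes>\<^bsub>G\<^esub> g) x l) = transl G M S g x l"
    using transl_transl[OF x h _ l, of "inv\<^bsub>G\<^esub> h \<otimes>\<^bsub>G\<^esub> g"] g h by simp
  then show ?thesis
    using transl_isotropy[OF x k l] by simp
qed

section \<open>The pointwise module structure on F(S, M)\<close>

lemma F_mod_simps:
  "\<zero>\<^bsub>F_mod G M S\<^esub> = (\<lambda>x\<in>elems S. \<zero>\<^bsub>Ob M (isotropy G S x)\<^esub>)"
  "u \<oplus>\<^bsub>F_mod G M S\<^esub> v = (\<lambda>x\<in>elems S. u x \<oplus>\<^bsub>Ob M (isotropy G S x)\<^esub> v x)"
  "r \<odot>\<^bsub>F_mod G M S\<^esub> u = (\<lambda>x\<in>elems S. r \<odot>\<^bsub>Ob M (isotropy G S x)\<^esub> u x)"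
  by (simp_all add: F_mod_def)

lemma FG_mod_simps:
  "\<zero>\<^bsub>FG_mod G M S\<^esub> = \<zero>\<^bsub>F_mod G M S\<^esub>"
  "u \<oplus>\<^bsub>FG_mod G M S\<^esub> v = u \<oplus>\<^bsub>F_mod G M S\<^esub> v"
  "r \<odot>\<^bsub>FG_mod G M S\<^esub> u = r \<odot>\<^bsub>F_mod G M S\<^esub> u"
  "u \<in> carrier (FG_mod G M S) \<longleftrightarrow>
     u \<in> carrier (F_mod G M S) \<and> (\<forall>g \<in> carrier G. F_act G M S g u = u)"
  by (simp_all add: FG_mod_def)

definition supp :: "('s \<Rightarrow> 'm) \<Rightarrow> 's set" where
  "supp u = {x \<in> elems S. u x \<noteq> \<zero>\<^bsub>Ob M (isotropy G S x)\<^esub>}"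

lemma F_mod_mem:
  "u \<in> carrier (F_mod G M S) \<longleftrightarrow>
     u \<in> extensional (elems S) \<and> (\<forall>x\<in>elems S. u x \<in> carrier (Ob M (isotropy G S x))) \<and>
     u (base S) = \<zero>\<^bsub>Ob M (isotropy G S (base S))\<^esub> \<and> finite (supp u)"
  by (auto simp: F_mod_def supp_def PiE_def)

lemma F_mod_app:
  "u \<in> carrier (F_mod G M S) \<Longrightarrow> x \<in> elems S \<Longrightarrow> u x \<in> carrier (Ob M (isotropy G S x))"
  by (simp add: F_mod_mem)

lemma F_mod_ext:
  assumes "u \<in> carrier (F_mod G M S)" "v \<in> carrier (F_mod G M S)"
    and "\<And>x. x \<in> elems S \<Longrightarrow> u x = v x"
  shows "u = v"
  using assms by (auto simp: F_mod_mem intro: extensionalityI)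

lemma zero_mem_F_mod: "\<zero>\<^bsub>F_mod G M S\<^esub> \<in> carrier (F_mod G M S)"
proof -
  have "supp \<zero>\<^bsub>F_mod G M S\<^esub> = {}"
    by (auto simp: supp_def F_mod_simps)
  moreover have "\<zero>\<^bsub>Ob M (isotropy G S x)\<^esub> \<in> carrier (Ob M (isotropy G S x))" if "x \<in> elems S" for x
    using abelian_groupE(2)[OF abelian_group_at[OF that]] .
  ultimately show ?thesis
    by (simp add: F_mod_mem F_mod_simps base_mem)
qed

lemma add_mem_F_mod:
  assumes u: "u \<in> carrier (F_mod G M S)" and v: "v \<in> carrier (F_mod G M S)"
  shows "u \<oplus>\<^bsub>F_mod G M S\<^esub> v \<in> carrier (F_mod G M S)"
proof -
  have "supp (u \<oplus>\<^bsub>F_mod G M S\<^esub> v) \<subseteq> supp u \<union> supp v"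
  proof
    fix x assume x: "x \<in> supp (u \<oplus>\<^bsub>F_mod G M S\<^esub> v)"
    then have xS: "x \<in> elems S"
      by (simp add: supp_def)
    interpret N: abelian_group "Ob M (isotropy G S x)"
      by (rule abelian_group_at[OF xS])
    show "x \<in> supp u \<union> supp v"
      using x by (auto simp: supp_def F_mod_simps)
  qed
  then have "finite (supp (u \<oplus>\<^bsub>F_mod G M S\<^esub> v))"
    using u v finite_subset by (fastforce simp: F_mod_mem)
  moreover have "u x \<oplus>\<^bsub>Ob M (isotropy G S x)\<^esub> v x \<in> carrier (Ob M (isotropy G S x))"
    if "x \<in> elems S" for x
    using abelian_groupE(1)[OF abelian_group_at[OF that]] u v that by (simp add: F_mod_mem)
  moreover have "u (base S) \<oplus>\<^bsub>Ob M (isotropy G S (base S))\<^esub> v (base S) = \<zero>\<^bsub>Ob M (isotropy G S (base S))\<^esub>"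
    using abelian_groupE(2,5)[OF abelian_group_at[OF base_mem]] u v by (simp add: F_mod_mem)
  ultimately show ?thesis
    by (simp add: F_mod_mem F_mod_simps base_mem)
qed

lemma smult_mem_F_mod:
  assumes r: "r \<in> carrier R" and u: "u \<in> carrier (F_mod G M S)"
  shows "r \<odot>\<^bsub>F_mod G M S\<^esub> u \<in> carrier (F_mod G M S)"
proof -
  have sm0: "r \<odot>\<^bsub>Ob M (isotropy G S x)\<^esub> \<zero>\<^bsub>Ob M (isotropy G S x)\<^esub> = \<zero>\<^bsub>Ob M (isotropy G S x)\<^esub>"
    if "x \<in> elems S" for x
    using Module.module.smult_r_null[OF module_at[OF that] r] .
  have "supp (r \<odot>\<^bsub>F_mod G M S\<^esub> u) \<subseteq> supp u"
    by (auto simp: supp_def F_mod_simps sm0)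
  then have "finite (supp (r \<odot>\<^bsub>F_mod G M S\<^esub> u))"
    using u finite_subset by (auto simp: F_mod_mem)
  moreover have "r \<odot>\<^bsub>Ob M (isotropy G S x)\<^esub> u x \<in> carrier (Ob M (isotropy G S x))"
    if "x \<in> elems S" for x
    using Module.module.smult_closed[OF module_at[OF that] r] u that by (simp add: F_mod_mem)
  ultimately show ?thesis
    using u sm0[OF base_mem] by (simp add: F_mod_mem F_mod_simps base_mem)
qed

text \<open>The inverse is written out pointwise because negation in \<open>F_mod\<close> has no
  known values until the group axioms are established.\<close>

lemma inverse_mem_F_mod:
  assumes u: "u \<in> carrier (F_mod G M S)"
  defines "v \<equiv> \<lambda>x\<in>elems S. \<ominus>\<^bsub>Ob M (isotropy G S x)\<^esub> u x"
  shows "v \<in> carrier (F_mod G M S)" and "v \<oplus>\<^bsub>F_mod G M S\<^esub> u = \<zero>\<^bsub>F_mod G M S\<^esub>"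
proof -
  have inv: "\<ominus>\<^bsub>Ob M (isotropy G S x)\<^esub> u x \<in> carrier (Ob M (isotropy G S x))"
    "\<ominus>\<^bsub>Ob M (isotropy G S x)\<^esub> u x \<oplus>\<^bsub>Ob M (isotropy G S x)\<^esub> u x = \<zero>\<^bsub>Ob M (isotropy G S x)\<^esub>"
    "\<ominus>\<^bsub>Ob M (isotropy G S x)\<^esub> \<zero>\<^bsub>Ob M (isotropy G S x)\<^esub> = \<zero>\<^bsub>Ob M (isotropy G S x)\<^esub>"
    if x: "x \<in> elems S" for x
  proof -
    interpret N: abelian_group "Ob M (isotropy G S x)"
      by (rule abelian_group_at[OF x])
    show "\<ominus>\<^bsub>Ob M (isotropy G S x)\<^esub> u x \<in> carrier (Ob M (isotropy G S x))"
      "\<ominus>\<^bsub>Ob M (isotropy G S x)\<^esub> u x \<oplus>\<^bsub>Ob M (isotropy G S x)\<^esub> u x = \<zero>\<^bsub>Ob M (isotropy G S x)\<^esub>"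
      "\<ominus>\<^bsub>Ob M (isotropy G S x)\<^esub> \<zero>\<^bsub>Ob M (isotropy G S x)\<^esub> = \<zero>\<^bsub>Ob M (isotropy G S x)\<^esub>"
      using F_mod_app[OF u x] by (simp_all add: N.l_neg)
  qed
  have "supp v \<subseteq> supp u"
    by (auto simp: supp_def v_def inv)
  then have "finite (supp v)"
    using u finite_subset by (auto simp: F_mod_mem)
  then show "v \<in> carrier (F_mod G M S)"
    using u inv base_mem by (simp add: F_mod_mem v_def)
  show "v \<oplus>\<^bsub>F_mod G M S\<^esub> u = \<zero>\<^bsub>F_mod G M S\<^esub>"
    by (auto simp: F_mod_simps v_def inv)
qed

lemma abelian_group_F_mod: "abelian_group (F_mod G M S)"
proof (rule abelian_groupI)
  fix u v w
  assume u: "u \<in> carrier (F_mod G M S)" and v: "v \<in> carrier (F_mod G M S)"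
    and w: "w \<in> carrier (F_mod G M S)"
  show "u \<oplus>\<^bsub>F_mod G M S\<^esub> v \<oplus>\<^bsub>F_mod G M S\<^esub> w = u \<oplus>\<^bsub>F_mod G M S\<^esub> (v \<oplus>\<^bsub>F_mod G M S\<^esub> w)"
    unfolding F_mod_simps
    using abelian_groupE(3)[OF abelian_group_at] F_mod_app u v w by (intro restrict_ext) simp
next
  fix u v
  assume u: "u \<in> carrier (F_mod G M S)" and v: "v \<in> carrier (F_mod G M S)"
  show "u \<oplus>\<^bsub>F_mod G M S\<^esub> v = v \<oplus>\<^bsub>F_mod G M S\<^esub> u"
    unfolding F_mod_simps
    using abelian_groupE(4)[OF abelian_group_at] F_mod_app u v by (intro restrict_ext) simp
next
  fix u
  assume u: "u \<in> carrier (F_mod G M S)"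
  show "\<zero>\<^bsub>F_mod G M S\<^esub> \<oplus>\<^bsub>F_mod G M S\<^esub> u = u"
  proof (rule F_mod_ext)
    fix x assume "x \<in> elems S"
    then show "(\<zero>\<^bsub>F_mod G M S\<^esub> \<oplus>\<^bsub>F_mod G M S\<^esub> u) x = u x"
      using abelian_groupE(5)[OF abelian_group_at] F_mod_app u by (simp add: F_mod_simps)
  qed (simp_all add: u add_mem_F_mod zero_mem_F_mod)
  show "\<exists>v\<in>carrier (F_mod G M S). v \<oplus>\<^bsub>F_mod G M S\<^esub> u = \<zero>\<^bsub>F_mod G M S\<^esub>"
    using inverse_mem_F_mod[OF u] by blast
qed (simp_all add: add_mem_F_mod zero_mem_F_mod)

text \<open>\<open>F_act\<close> reads its value at y from the point \<open>inv g\<close> y;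
  substituting y = gx removes the inverse. In this form an invariant function is visibly determined
  on an orbit by a single value.\<close>

lemma invariant_iff:
  assumes u: "u \<in> carrier (F_mod G M S)"
  shows "u \<in> carrier (FG_mod G M S) \<longleftrightarrow>
     (\<forall>g\<in>carrier G. \<forall>x\<in>elems S. u (act S g x) = transl G M S g x (u x))"
proof
  assume L: "u \<in> carrier (FG_mod G M S)"
  show "\<forall>g\<in>carrier G. \<forall>x\<in>elems S. u (act S g x) = transl G M S g x (u x)"
  proof (intro ballI)
    fix g x assume g: "g \<in> carrier G" and x: "x \<in> elems S"
    have "F_act G M S g u (act S g x) = u (act S g x)"
      using L g by (simp add: FG_mod_simps)
    then show "u (act S g x) = transl G M S g x (u x)"
      using g x by (simp add: F_act_def act_closed act_inv_act Let_def)
  qed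
next
  assume Rt: "\<forall>g\<in>carrier G. \<forall>x\<in>elems S. u (act S g x) = transl G M S g x (u x)"
  have "F_act G M S g u = u" if g: "g \<in> carrier G" for g
  proof (rule extensionalityI[of _ "elems S"])
    show "F_act G M S g u \<in> extensional (elems S)"
      by (simp add: F_act_def)
    show "u \<in> extensional (elems S)"
      using u by (simp add: F_mod_mem)
    fix y assume y: "y \<in> elems S"
    then show "F_act G M S g u y = u y"
      using Rt[rule_format, OF g, of "act S (inv\<^bsub>G\<^esub> g) y"] g
      by (simp add: F_act_def act_closed act_inv_act Let_def)
  qed
  then show "u \<in> carrier (FG_mod G M S)"
    using u by (simp add: FG_mod_simps)
qed

section \<open>The submodule of invariant functions\<close>

lemma FG_mod_F_mod: "u \<in> carrier (FG_mod G M S) \<Longrightarrow> u \<in> carrier (F_mod G M S)"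
  by (simp add: FG_mod_simps)

lemma FG_mod_act:
  "u \<in> carrier (FG_mod G M S) \<Longrightarrow> g \<in> carrier G \<Longrightarrow> x \<in> elems S \<Longrightarrow>
     u (act S g x) = transl G M S g x (u x)"
  using invariant_iff FG_mod_F_mod by blast

lemma zero_mem_FG_mod: "\<zero>\<^bsub>FG_mod G M S\<^esub> \<in> carrier (FG_mod G M S)"
  unfolding invariant_iff[OF zero_mem_F_mod] FG_mod_simps(1)
  by (simp add: F_mod_simps act_closed transl_zero)

lemma add_mem_FG_mod:
  assumes u: "u \<in> carrier (FG_mod G M S)" and v: "v \<in> carrier (FG_mod G M S)"
  shows "u \<oplus>\<^bsub>FG_mod G M S\<^esub> v \<in> carrier (FG_mod G M S)"
  unfolding FG_mod_simps(2) invariant_iff[OF add_mem_F_mod[OF u[THEN FG_mod_F_mod] v[THEN FG_mod_F_mod]]]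
  using FG_mod_act[OF u] FG_mod_act[OF v] F_mod_app FG_mod_F_mod[OF u] FG_mod_F_mod[OF v]
  by (simp add: F_mod_simps act_closed transl_add)

lemma smult_mem_FG_mod:
  assumes r: "r \<in> carrier R" and u: "u \<in> carrier (FG_mod G M S)"
  shows "r \<odot>\<^bsub>FG_mod G M S\<^esub> u \<in> carrier (FG_mod G M S)"
  unfolding FG_mod_simps(3) invariant_iff[OF smult_mem_F_mod[OF r u[THEN FG_mod_F_mod]]]
  using FG_mod_act[OF u] F_mod_app FG_mod_F_mod[OF u] r
  by (simp add: F_mod_simps act_closed transl_smult)

lemma abelian_group_FG_mod: "abelian_group (FG_mod G M S)"
proof -
  interpret F: abelian_group "F_mod G M S"
    by (rule abelian_group_F_mod)
  show ?thesis
  proof (rule abelian_groupI)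
    fix u assume u: "u \<in> carrier (FG_mod G M S)"
    define v where "v = (\<lambda>x\<in>elems S. \<ominus>\<^bsub>Ob M (isotropy G S x)\<^esub> u x)"
    note v = inverse_mem_F_mod[OF u[THEN FG_mod_F_mod], folded v_def]
    have "v (act S g x) = transl G M S g x (v x)" if g: "g \<in> carrier G" and x: "x \<in> elems S" for g x
    proof -
      have gx: "act S g x \<in> elems S"
        using g x by (rule act_closed)
      interpret N: abelian_group "Ob M (isotropy G S x)"
        by (rule abelian_group_at[OF x])
      interpret gN: abelian_group "Ob M (isotropy G S (act S g x))"
        by (rule abelian_group_at[OF gx])
      have ux: "u x \<in> carrier (Ob M (isotropy G S x))"
        using F_mod_app[OF FG_mod_F_mod[OF u] x] .
      \<comment> \<open>Translation is additive and preserves zero, so it sends negatives to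
        negatives; uniqueness of inverses at gx then gives the invariance of v.\<close>
      have "transl G M S g x (\<ominus>\<^bsub>Ob M (isotropy G S x)\<^esub> u x) \<oplus>\<^bsub>Ob M (isotropy G S (act S g x))\<^esub> transl G M S g x (u x)
          = \<zero>\<^bsub>Ob M (isotropy G S (act S g x))\<^esub>"
        using transl_add[OF x g N.a_inv_closed[OF ux] ux] by (simp add: N.l_neg ux transl_zero x g)
      then show ?thesis
        using gN.minus_equality transl_closed[OF x g] ux FG_mod_act[OF u g x] gx x
        by (simp add: v_def)
    qed
    then have "v \<in> carrier (FG_mod G M S)"
      using invariant_iff[OF v(1)] by blast
    then show "\<exists>v\<in>carrier (FG_mod G M S). v \<oplus>\<^bsub>FG_mod G M S\<^esub> u = \<zero>\<^bsub>FG_mod G M S\<^esub>"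
      using v(2) by (auto simp: FG_mod_simps(1,2))
    show "\<zero>\<^bsub>FG_mod G M S\<^esub> \<oplus>\<^bsub>FG_mod G M S\<^esub> u = u"
      using F.l_zero FG_mod_F_mod[OF u] by (simp add: FG_mod_simps(1,2))
  qed (simp_all add: add_mem_FG_mod zero_mem_FG_mod,
      simp_all add: FG_mod_simps(1,2) FG_mod_F_mod F.a_ac)
qed

text \<open>Evaluation at a point is additive, which lets finite sums of functions be computed
  pointwise.\<close>

lemma eval_F_mod_hom:
  "x \<in> elems S \<Longrightarrow> (\<lambda>u. u x) \<in> hom (add_monoid (F_mod G M S)) (add_monoid (Ob M (isotropy G S x)))"
  by (auto simp: hom_def F_mod_app F_mod_simps)

lemma eval_FG_mod_hom:
  "x \<in> elems S \<Longrightarrow> (\<lambda>u. u x) \<in> hom (add_monoid (FG_mod G M S)) (add_monoid (Ob M (isotropy G S x)))"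
  by (auto simp: hom_def F_mod_app FG_mod_F_mod F_mod_simps FG_mod_simps(1,2))

lemma finsum_F_mod_app:
  "x \<in> elems S \<Longrightarrow> f \<in> I \<rightarrow> carrier (F_mod G M S) \<Longrightarrow>
     finsum (F_mod G M S) f I x = finsum (Ob M (isotropy G S x)) (\<lambda>i. f i x) I"
  using finsum_hom[OF abelian_group.axioms(1)[OF abelian_group_F_mod]
      abelian_group.axioms(1)[OF abelian_group_at] eval_F_mod_hom]
  by (simp add: F_mod_simps)

lemma finsum_FG_mod_app:
  "x \<in> elems S \<Longrightarrow> f \<in> I \<rightarrow> carrier (FG_mod G M S) \<Longrightarrow>
     finsum (FG_mod G M S) f I x = finsum (Ob M (isotropy G S x)) (\<lambda>i. f i x) I"
  using finsum_hom[OF abelian_group.axioms(1)[OF abelian_group_FG_mod]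
      abelian_group.axioms(1)[OF abelian_group_at] eval_FG_mod_hom]
  by (simp add: F_mod_simps FG_mod_simps(1))

end

section \<open>The generators \<open>\<gamma>\<^sup>G\<^sub>x(l)\<close>\<close>

lemma hom_zero:
  assumes A: "abelian_group A" and B: "abelian_group B"
    and h: "h \<in> hom (add_monoid A) (add_monoid B)"
  shows "h \<zero>\<^bsub>A\<^esub> = \<zero>\<^bsub>B\<^esub>"
  using group_hom.hom_one[OF group_hom.intro[OF abelian_group.a_group[OF A] abelian_group.a_group[OF B]
        group_hom_axioms.intro[OF h]]]
  by simp

context coefficient_gset
begin

section \<open>Values of a generator on and off its orbit\<close>

abbreviation orb :: "'s \<Rightarrow> 's set" where
  "orb x \<equiv> orbit G (act S) x"

lemma orb_iff: "y \<in> orb x \<longleftrightarrow> (\<exists>g\<in>carrier G. y = act S g x)"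
  by (auto simp: orbit_def)

lemma orb_act:
  assumes "x \<in> elems S" "g \<in> carrier G"
  shows "orb (act S g x) = orb x"
proof -
  have "act S h (act S g x) \<in> orb x" if "h \<in> carrier G" for h
    using that assms by (auto simp: orb_iff act_mult intro!: bexI[of _ "h \<otimes>\<^bsub>G\<^esub> g"])
  moreover have "act S h x \<in> orb (act S g x)" if "h \<in> carrier G" for h
    using that assms
    by (auto simp: orb_iff act_mult act_closed act_inv_act intro!: bexI[of _ "h \<otimes>\<^bsub>G\<^esub> inv\<^bsub>G\<^esub> g"])
  ultimately show ?thesis
    by (auto simp: orb_iff[of _ x] orb_iff[of _ "act S g x"])
qed

lemma orb_refl: "x \<in> elems S \<Longrightarrow> x \<in> orb x"
  unfolding orb_iff by (rule bexI[of _ "\<one>\<^bsub>G\<^esub>"]) (simp_all add: act_one)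

lemma F_single_mem:
  assumes x: "x \<in> elems S" and l: "l \<in> carrier (Ob M (isotropy G S x))"
  shows "F_single G M S l x \<in> carrier (F_mod G M S)"
proof -
  have "\<zero>\<^bsub>Ob M (isotropy G S y)\<^esub> \<in> carrier (Ob M (isotropy G S y))" if "y \<in> elems S" for y
    using abelian_groupE(2)[OF abelian_group_at[OF that]] .
  moreover have "supp (F_single G M S l x) \<subseteq> {x}"
    by (auto simp: supp_def F_single_def)
  ultimately show ?thesis
    using l base_mem finite_subset[of "supp (F_single G M S l x)" "{x}"]
    by (auto simp: F_mod_mem F_single_def)
qed

lemma coset_rep:
  assumes x: "x \<in> elems S" and C: "C \<in> lcosets\<^bsub>G\<^esub> (isotropy G S x)"
  shows "(SOME g. g \<in> C) \<in> carrier G" "(SOME g. g \<in> C) \<in> C"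
proof -
  obtain a where a: "a \<in> carrier G" "C = a <#\<^bsub>G\<^esub> isotropy G S x"
    using C by (elim lcosetsE)
  have "a \<in> C"
    using lcos_self[OF a(1) subgroup_isotropy[OF x]] a by simp
  then show mem: "(SOME g. g \<in> C) \<in> C"
    by (rule someI)
  have "C \<subseteq> carrier G"
    using l_coset_subset_G[OF subgroup.subset[OF subgroup_isotropy[OF x]] a(1)] a by simp
  then show "(SOME g. g \<in> C) \<in> carrier G"
    using mem by (rule subsetD)
qed

lemma mem_coset_isotropy:
  assumes x: "x \<in> elems S" and g: "g \<in> carrier G" and h: "h \<in> carrier G"
  shows "h \<in> g <#\<^bsub>G\<^esub> isotropy G S x \<longleftrightarrow> act S h x = act S g x"
proof
  assume "h \<in> g <#\<^bsub>G\<^esub> isotropy G S x"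
  then obtain k where k: "k \<in> isotropy G S x" "h = g \<otimes>\<^bsub>G\<^esub> k"
    by (auto simp: l_coset_def)
  then show "act S h x = act S g x"
    using x g by (simp add: mem_isotropy act_mult)
next
  assume "act S h x = act S g x"
  then have "inv\<^bsub>G\<^esub> g \<otimes>\<^bsub>G\<^esub> h \<in> isotropy G S x"
    using x g h by (simp add: mem_isotropy act_mult act_inv_act)
  moreover have "h = g \<otimes>\<^bsub>G\<^esub> (inv\<^bsub>G\<^esub> g \<otimes>\<^bsub>G\<^esub> h)"
    using g h by simp
  ultimately show "h \<in> g <#\<^bsub>G\<^esub> isotropy G S x"
    unfolding l_coset_def by blast
qed

definition gamma_term :: "'s \<Rightarrow> 'm \<Rightarrow> 'g set \<Rightarrow> 's \<Rightarrow> 'm" where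
  "gamma_term x l C = (let g = (SOME g. g \<in> C) in F_single G M S (transl G M S g x l) (act S g x))"

lemma gamma_term_mem:
  assumes "x \<in> elems S" "l \<in> carrier (Ob M (isotropy G S x))" "C \<in> lcosets\<^bsub>G\<^esub> (isotropy G S x)"
  shows "gamma_term x l C \<in> carrier (F_mod G M S)"
  unfolding gamma_term_def Let_def
  using assms coset_rep by (intro F_single_mem transl_closed act_closed) auto

lemma gamma_mem_F_mod:
  assumes "x \<in> elems S" "l \<in> carrier (Ob M (isotropy G S x))"
  shows "gamma G M S x l \<in> carrier (F_mod G M S)"
proof -
  interpret F: abelian_group "F_mod G M S"
    by (rule abelian_group_F_mod)
  show ?thesis
    unfolding gamma_def gamma_term_def[symmetric]
    using gamma_term_mem[OF assms] by (intro F.finsum_closed) auto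
qed

lemma gamma_app:
  assumes "x \<in> elems S" "l \<in> carrier (Ob M (isotropy G S x))" "y \<in> elems S"
  shows "gamma G M S x l y =
    finsum (Ob M (isotropy G S y)) (\<lambda>C. gamma_term x l C y) (lcosets\<^bsub>G\<^esub> (isotropy G S x))"
  unfolding gamma_def gamma_term_def[symmetric]
  using gamma_term_mem assms by (intro finsum_F_mod_app) auto

text \<open>Distinct cosets of the isotropy group move x to distinct points, so at gx only the
  summand of the coset of g survives.\<close>

lemma gamma_act:
  assumes x: "x \<in> elems S" and l: "l \<in> carrier (Ob M (isotropy G S x))" and nb: "x \<noteq> base S"
    and g: "g \<in> carrier G"
  shows "gamma G M S x l (act S g x) = transl G M S g x l"
proof -
  have gx: "act S g x \<in> elems S"
    using x g by (simp add: act_closed)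
  interpret N: abelian_group "Ob M (isotropy G S (act S g x))"
    by (rule abelian_group_at[OF gx])
  define C0 where "C0 = g <#\<^bsub>G\<^esub> isotropy G S x"
  have C0: "C0 \<in> lcosets\<^bsub>G\<^esub> (isotropy G S x)"
    using g by (simp add: C0_def l_coset_mem_lcosets)
  have tl: "transl G M S g x l \<in> carrier (Ob M (isotropy G S (act S g x)))"
    using x g l by (rule transl_closed)
  have "gamma_term x l C (act S g x) =
      (if C0 = C then transl G M S g x l else \<zero>\<^bsub>Ob M (isotropy G S (act S g x))\<^esub>)"
    if C: "C \<in> lcosets\<^bsub>G\<^esub> (isotropy G S x)" for C
  proof -
    define k where "k = (SOME g. g \<in> C)"
    have k: "k \<in> carrier G" "k \<in> C"
      unfolding k_def using coset_rep[OF x C] .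
    obtain a where a: "a \<in> carrier G" "C = a <#\<^bsub>G\<^esub> isotropy G S x"
      using C by (elim lcosetsE)
    have Ck: "C = k <#\<^bsub>G\<^esub> isotropy G S x"
      using l_repr_independence[OF _ a(1) subgroup_isotropy[OF x], of k] k(2) a(2) by simp
    have eq: "C0 = C \<longleftrightarrow> act S g x = act S k x"
    proof
      assume "C0 = C"
      then have "k \<in> g <#\<^bsub>G\<^esub> isotropy G S x"
        using k C0_def by simp
      then show "act S g x = act S k x"
        using mem_coset_isotropy[OF x g k(1)] by simp
    next
      assume "act S g x = act S k x"
      then have "k \<in> g <#\<^bsub>G\<^esub> isotropy G S x"
        using mem_coset_isotropy[OF x g k(1)] by simp
      then show "C0 = C"
        unfolding C0_def Ck using l_repr_independence[OF _ g subgroup_isotropy[OF x]] by simp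
    qed
    \<comment> \<open>The base point is its own orbit, so an orbit starting elsewhere avoids it and
      \<open>F_single\<close> does not fall into its zero branch.\<close>
    have "act S k x \<noteq> base S"
    proof
      assume "act S k x = base S"
      then have "x = act S (inv\<^bsub>G\<^esub> k) (base S)"
        using act_inv_act(1)[OF x k(1)] by simp
      then show False
        using nb base_fixed k(1) by simp
    qed
    then show ?thesis
      unfolding gamma_term_def k_def[symmetric] eq
      using gx transl_cong[OF x g k(1) _ l] by (simp add: F_single_def)
  qed
  then have "gamma G M S x l (act S g x) = finsum (Ob M (isotropy G S (act S g x)))
      (\<lambda>C. if C0 = C then transl G M S g x l else \<zero>\<^bsub>Ob M (isotropy G S (act S g x))\<^esub>)
      (lcosets\<^bsub>G\<^esub> (isotropy G S x))"
    unfolding gamma_app[OF x l gx] using tl by (intro N.finsum_cong') auto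
  also have "\<dots> = transl G M S g x l"
    using N.finsum_singleton[OF C0 finite_lcosets, of "\<lambda>_. transl G M S g x l"] tl by auto
  finally show ?thesis .
qed

text \<open>The second alternative reflects the convention that \<open>F_single\<close> at the base
  point is zero.\<close>

lemma gamma_off_orbit:
  assumes x: "x \<in> elems S" and l: "l \<in> carrier (Ob M (isotropy G S x))"
    and y: "y \<in> elems S" and off: "y \<notin> orb x \<or> x = base S"
  shows "gamma G M S x l y = \<zero>\<^bsub>Ob M (isotropy G S y)\<^esub>"
proof -
  interpret N: abelian_group "Ob M (isotropy G S y)"
    by (rule abelian_group_at[OF y])
  have "gamma_term x l C y = \<zero>\<^bsub>Ob M (isotropy G S y)\<^esub>" if "C \<in> lcosets\<^bsub>G\<^esub> (isotropy G S x)" for C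
    using off coset_rep(1)[OF x that] y
    by (auto simp: gamma_term_def Let_def F_single_def orb_iff base_fixed)
  then show ?thesis
    unfolding gamma_app[OF x l y] by (intro N.add.finprod_one_eqI) auto
qed

lemma gamma_base:
  assumes l: "l \<in> carrier (Ob M (isotropy G S (base S)))"
  shows "gamma G M S (base S) l = \<zero>\<^bsub>FG_mod G M S\<^esub>"
proof -
  have "gamma G M S (base S) l = \<zero>\<^bsub>F_mod G M S\<^esub>"
  proof (rule F_mod_ext)
    fix y assume "y \<in> elems S"
    then show "gamma G M S (base S) l y = \<zero>\<^bsub>F_mod G M S\<^esub> y"
      using gamma_off_orbit[OF base_mem l] by (simp add: F_mod_simps)
  qed (simp_all add: gamma_mem_F_mod base_mem l zero_mem_F_mod)
  then show ?thesis
    by (simp add: FG_mod_simps(1))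
qed

lemma gamma_mem:
  assumes x: "x \<in> elems S" and l: "l \<in> carrier (Ob M (isotropy G S x))"
  shows "gamma G M S x l \<in> carrier (FG_mod G M S)"
proof (cases "x = base S")
  case True
  then show ?thesis
    using gamma_base l zero_mem_FG_mod by simp
next
  case False
  have "gamma G M S x l (act S g y) = transl G M S g y (gamma G M S x l y)"
    if g: "g \<in> carrier G" and y: "y \<in> elems S" for g y
  proof (cases "y \<in> orb x")
    case True
    then obtain h where h: "h \<in> carrier G" "y = act S h x"
      by (auto simp: orb_iff)
    then have "act S g y = act S (g \<otimes>\<^bsub>G\<^esub> h) x"
      using x g by (simp add: act_mult)
    then have "gamma G M S x l (act S g y) = transl G M S (g \<otimes>\<^bsub>G\<^esub> h) x l"
      using gamma_act[OF x l False] g h by simp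
    also have "\<dots> = transl G M S g y (gamma G M S x l y)"
      using transl_transl[OF x g h(1) l] gamma_act[OF x l False h(1)] h(2) by simp
    finally show ?thesis .
  next
    case off: False
    have gy: "act S g y \<in> elems S"
      using g y by (rule act_closed)
    have "act S g y \<notin> orb x"
    proof
      assume "act S g y \<in> orb x"
      then obtain h where "h \<in> carrier G" "act S g y = act S h x"
        by (auto simp: orb_iff)
      then have "orb y = orb x"
        using orb_act x y g by metis
      then show False
        using off orb_refl[OF y] by simp
    qed
    then show ?thesis
      using gamma_off_orbit[OF x l] off y g gy by (simp add: transl_zero)
  qed
  then show ?thesis
    using invariant_iff[OF gamma_mem_F_mod[OF x l]] by blast
qed

text \<open>By invariance, the value at x fixes u on the whole orbit, so comparing one value and
  checking that u vanishes off the orbit suffices. The identities for \<open>gamma\<close> away from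
  the base point are proved this way.\<close>

lemma gamma_eqI:
  assumes u: "u \<in> carrier (FG_mod G M S)" and x: "x \<in> elems S" and nb: "x \<noteq> base S"
    and ux: "u x = l"
    and off: "\<And>y. y \<in> elems S \<Longrightarrow> y \<notin> orb x \<Longrightarrow> u y = \<zero>\<^bsub>Ob M (isotropy G S y)\<^esub>"
  shows "gamma G M S x l = u"
proof (rule F_mod_ext)
  have l: "l \<in> carrier (Ob M (isotropy G S x))"
    using F_mod_app[OF FG_mod_F_mod[OF u] x] ux by simp
  then show "gamma G M S x l \<in> carrier (F_mod G M S)"
    using x by (rule gamma_mem_F_mod[rotated])
  show "u \<in> carrier (F_mod G M S)"
    using u by (rule FG_mod_F_mod)
  fix y assume y: "y \<in> elems S"
  show "gamma G M S x l y = u y"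
  proof (cases "y \<in> orb x")
    case True
    then obtain g where "g \<in> carrier G" "y = act S g x"
      by (auto simp: orb_iff)
    then show ?thesis
      using gamma_act[OF x l nb] FG_mod_act[OF u _ x] ux by simp
  next
    case False
    then show ?thesis
      using off gamma_off_orbit[OF x l y] y by simp
  qed
qed

lemma gamma_self:
  assumes x: "x \<in> elems S" and l: "l \<in> carrier (Ob M (isotropy G S x))" and nb: "x \<noteq> base S"
  shows "gamma G M S x l x = l"
  using gamma_act[OF x l nb, of "\<one>\<^bsub>G\<^esub>"] transl_isotropy[OF x _ l, of "\<one>\<^bsub>G\<^esub>"] x
  by (simp add: act_one mem_isotropy)

text \<open>Generators belong to orbits rather than points: moving x along its orbit is compensated
  by translating the coefficient. The effect of \<open>pushforward\<close> on a generator is freed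
  from the chosen representative by this rule.\<close>

lemma gamma_transl:
  assumes x: "x \<in> elems S" and l: "l \<in> carrier (Ob M (isotropy G S x))" and g: "g \<in> carrier G"
  shows "gamma G M S (act S g x) (transl G M S g x l) = gamma G M S x l"
proof (cases "x = base S")
  case True
  then show ?thesis
    using gamma_base transl_closed[OF x g l] l g by (simp add: base_fixed)
next
  case False
  have nb: "act S g x \<noteq> base S"
    using False act_inv_act(1)[OF x g] base_fixed[of "inv\<^bsub>G\<^esub> g"] g by fastforce
  show ?thesis
    by (rule gamma_eqI)
      (use x l g nb False in \<open>simp_all add: gamma_mem act_closed gamma_act orb_act gamma_off_orbit\<close>)
qed

lemma gamma_add:
  assumes x: "x \<in> elems S" and l: "l \<in> carrier (Ob M (isotropy G S x))"
    and l': "l' \<in> carrier (Ob M (isotropy G S x))"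
  shows "gamma G M S x (l \<oplus>\<^bsub>Ob M (isotropy G S x)\<^esub> l') =
    gamma G M S x l \<oplus>\<^bsub>FG_mod G M S\<^esub> gamma G M S x l'"
proof (cases "x = base S")
  case True
  then show ?thesis
    using gamma_base l l' abelian_groupE(1)[OF abelian_group_at[OF x] l l']
      abelian_groupE(2,5)[OF abelian_group_FG_mod] by simp
next
  case False
  have z: "\<zero>\<^bsub>Ob M (isotropy G S y)\<^esub> \<oplus>\<^bsub>Ob M (isotropy G S y)\<^esub> \<zero>\<^bsub>Ob M (isotropy G S y)\<^esub> = \<zero>\<^bsub>Ob M (isotropy G S y)\<^esub>"
    if "y \<in> elems S" for y
    using abelian_groupE(2,5)[OF abelian_group_at[OF that]] by simp
  show ?thesis
  proof (rule gamma_eqI[OF _ x False])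
    show "gamma G M S x l \<oplus>\<^bsub>FG_mod G M S\<^esub> gamma G M S x l' \<in> carrier (FG_mod G M S)"
      by (simp add: add_mem_FG_mod gamma_mem x l l')
  qed (simp_all add: FG_mod_simps(2) F_mod_simps(2) x l l' gamma_self False gamma_off_orbit z)
qed

lemma gamma_smult:
  assumes x: "x \<in> elems S" and l: "l \<in> carrier (Ob M (isotropy G S x))" and r: "r \<in> carrier R"
  shows "gamma G M S x (r \<odot>\<^bsub>Ob M (isotropy G S x)\<^esub> l) = r \<odot>\<^bsub>FG_mod G M S\<^esub> gamma G M S x l"
proof -
  have z: "r \<odot>\<^bsub>Ob M (isotropy G S y)\<^esub> \<zero>\<^bsub>Ob M (isotropy G S y)\<^esub> = \<zero>\<^bsub>Ob M (isotropy G S y)\<^esub>"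
    if "y \<in> elems S" for y
    using Module.module.smult_r_null[OF module_at[OF that] r] .
  show ?thesis
  proof (cases "x = base S")
    case True
    have "r \<odot>\<^bsub>FG_mod G M S\<^esub> \<zero>\<^bsub>FG_mod G M S\<^esub> = \<zero>\<^bsub>FG_mod G M S\<^esub>"
      unfolding FG_mod_simps F_mod_simps by (intro restrict_ext) (simp add: z)
    then show ?thesis
      using gamma_base True l Module.module.smult_closed[OF module_at[OF x] r l] by simp
  next
    case False
    show ?thesis
    proof (rule gamma_eqI[OF _ x False])
      show "r \<odot>\<^bsub>FG_mod G M S\<^esub> gamma G M S x l \<in> carrier (FG_mod G M S)"
        by (simp add: smult_mem_FG_mod gamma_mem x l r)
    qed (simp_all add: FG_mod_simps(3) F_mod_simps(3) x l gamma_self False gamma_off_orbit z)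
  qed
qed

lemma gamma_zero:
  assumes x: "x \<in> elems S"
  shows "gamma G M S x \<zero>\<^bsub>Ob M (isotropy G S x)\<^esub> = \<zero>\<^bsub>FG_mod G M S\<^esub>"
proof (cases "x = base S")
  case True
  then show ?thesis
    using gamma_base abelian_groupE(2)[OF abelian_group_at[OF x]] by simp
next
  case False
  show ?thesis
    by (rule gamma_eqI[OF zero_mem_FG_mod x False]) (simp_all add: FG_mod_simps(1) F_mod_simps(1) x)
qed

section \<open>Orbit representatives and decomposition into generators\<close>

definition orbit_rep :: "'s \<Rightarrow> 's" where
  "orbit_rep x = (SOME y. y \<in> orb x)"

lemma orbit_repE:
  assumes "x \<in> elems S"
  obtains g where "g \<in> carrier G" "orbit_rep x = act S g x"
  using someI[of "\<lambda>y. y \<in> orb x", OF orb_refl[OF assms]] by (auto simp: orbit_rep_def orb_iff)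

text \<open>\<open>SOME\<close> sees only the set \<open>orb x\<close>, so equal orbits receive the
  same representative.\<close>

lemma orbit_rep_act: "x \<in> elems S \<Longrightarrow> g \<in> carrier G \<Longrightarrow> orbit_rep (act S g x) = orbit_rep x"
  by (simp add: orbit_rep_def orb_act)

definition orbit_reps :: "'s set" where
  "orbit_reps = orbit_rep ` elems S"

lemma orbit_reps_subset: "orbit_reps \<subseteq> elems S"
proof
  fix y assume "y \<in> orbit_reps"
  then obtain x where x: "x \<in> elems S" "y = orbit_rep x"
    by (auto simp: orbit_reps_def)
  obtain g where "g \<in> carrier G" "orbit_rep x = act S g x"
    using orbit_repE[OF x(1)] .
  then show "y \<in> elems S"
    using x act_closed by simp
qed

lemma orbit_rep_self: "x \<in> orbit_reps \<Longrightarrow> orbit_rep x = x"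
  unfolding orbit_reps_def by (metis imageE orbit_repE orbit_rep_act)

lemma FG_mod_orbit_rep_zero:
  assumes u: "u \<in> carrier (FG_mod G M S)" and y: "y \<in> elems S"
    and 0: "orbit_rep y \<notin> supp u"
  shows "u y = \<zero>\<^bsub>Ob M (isotropy G S y)\<^esub>"
proof -
  obtain g where g: "g \<in> carrier G" "orbit_rep y = act S g y"
    using orbit_repE[OF y] .
  have gy: "act S g y \<in> elems S"
    using g(1) y by (rule act_closed)
  have "u (act S g y) = \<zero>\<^bsub>Ob M (isotropy G S (act S g y))\<^esub>"
    using 0 g gy by (simp add: supp_def)
  then show ?thesis
    using FG_mod_act[OF u inv_closed[OF g(1)] gy] transl_zero[OF gy inv_closed[OF g(1)]]
    by (simp add: act_inv_act y g(1))
qed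

text \<open>For a representative x, the test \<open>orbit_rep y = x\<close> says that y lies in the
  orbit of x. There both functions are invariant and agree at x, hence at y.\<close>

lemma gamma_value_app:
  assumes u: "u \<in> carrier (FG_mod G M S)" and x: "x \<in> orbit_reps" and y: "y \<in> elems S"
  shows "gamma G M S x (u x) y = (if orbit_rep y = x then u y else \<zero>\<^bsub>Ob M (isotropy G S y)\<^esub>)"
proof -
  have xS: "x \<in> elems S"
    using x orbit_reps_subset by blast
  have ux: "u x \<in> carrier (Ob M (isotropy G S x))"
    using F_mod_app[OF FG_mod_F_mod[OF u] xS] .
  show ?thesis
  proof (cases "orbit_rep y = x")
    case True
    obtain g where g: "g \<in> carrier G" "orbit_rep y = act S g y"
      using orbit_repE[OF y] .
    have yx: "y = act S (inv\<^bsub>G\<^esub> g) x"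
      using g True act_inv_act(1)[OF y g(1)] by simp
    show ?thesis
    proof (cases "x = base S")
      case xb: True
      then have "y = base S"
        using yx g base_fixed by simp
      then show ?thesis
        using xb gamma_off_orbit[OF xS ux y] FG_mod_F_mod[OF u] by (simp add: F_mod_mem)
    next
      case False
      then show ?thesis
        using True gamma_act[OF xS ux False inv_closed[OF g(1)]] FG_mod_act[OF u inv_closed[OF g(1)] xS]
        by (simp add: yx[symmetric])
    qed
  next
    case False
    have "y \<notin> orb x"
      using False orbit_rep_self[OF x] orbit_rep_act[OF xS] by (auto simp: orb_iff)
    then show ?thesis
      using gamma_off_orbit[OF xS ux y] False by simp
  qed
qed

text \<open>Evaluated at y, only the summand of the representative of y can survive, and it
  contributes \<open>u y\<close>. If that representative is outside the support, no summand survives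
  and \<open>u y\<close> is zero as well.\<close>

lemma FG_mod_decomposition:
  assumes u: "u \<in> carrier (FG_mod G M S)"
  shows "u = (\<Oplus>\<^bsub>FG_mod G M S\<^esub>x\<in>supp u \<inter> orbit_reps. gamma G M S x (u x))"
proof (rule F_mod_ext)
  interpret FG: abelian_group "FG_mod G M S"
    by (rule abelian_group_FG_mod)
  have mem: "(\<lambda>x. gamma G M S x (u x)) \<in> supp u \<inter> orbit_reps \<rightarrow> carrier (FG_mod G M S)"
  proof (rule funcsetI)
    fix x assume "x \<in> supp u \<inter> orbit_reps"
    then have x: "x \<in> elems S"
      by (simp add: supp_def)
    show "gamma G M S x (u x) \<in> carrier (FG_mod G M S)"
      using gamma_mem[OF x F_mod_app[OF FG_mod_F_mod[OF u] x]] .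
  qed
  show "u \<in> carrier (F_mod G M S)"
    using u by (rule FG_mod_F_mod)
  show "(\<Oplus>\<^bsub>FG_mod G M S\<^esub>x\<in>supp u \<inter> orbit_reps. gamma G M S x (u x)) \<in> carrier (F_mod G M S)"
    using FG.finsum_closed[OF mem] by (rule FG_mod_F_mod)
  fix y assume y: "y \<in> elems S"
  interpret N: abelian_group "Ob M (isotropy G S y)"
    by (rule abelian_group_at[OF y])
  have uy: "u y \<in> carrier (Ob M (isotropy G S y))"
    using F_mod_app[OF FG_mod_F_mod[OF u] y] .
  have "(\<Oplus>\<^bsub>FG_mod G M S\<^esub>x\<in>supp u \<inter> orbit_reps. gamma G M S x (u x)) y =
      (\<Oplus>\<^bsub>Ob M (isotropy G S y)\<^esub>x\<in>supp u \<inter> orbit_reps. gamma G M S x (u x) y)"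
    by (rule finsum_FG_mod_app[OF y mem])
  also have "\<dots> = (\<Oplus>\<^bsub>Ob M (isotropy G S y)\<^esub>x\<in>supp u \<inter> orbit_reps.
      if orbit_rep y = x then u y else \<zero>\<^bsub>Ob M (isotropy G S y)\<^esub>)"
    using gamma_value_app[OF u _ y] uy by (intro N.finsum_cong') auto
  also have "\<dots> = u y"
  proof (cases "orbit_rep y \<in> supp u")
    case True
    then have "orbit_rep y \<in> supp u \<inter> orbit_reps"
      using y by (simp add: orbit_reps_def)
    moreover have "finite (supp u \<inter> orbit_reps)"
      using FG_mod_F_mod[OF u] by (simp add: F_mod_mem)
    ultimately show ?thesis
      using N.finsum_singleton[of "orbit_rep y" "supp u \<inter> orbit_reps" "\<lambda>_. u y"] uy by auto
  next
    case False
    then have "(\<Oplus>\<^bsub>Ob M (isotropy G S y)\<^esub>x\<in>supp u \<inter> orbit_reps.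
      if orbit_rep y = x then u y else \<zero>\<^bsub>Ob M (isotropy G S y)\<^esub>) = \<zero>\<^bsub>Ob M (isotropy G S y)\<^esub>"
      by (intro N.add.finprod_one_eqI[simplified]) auto
    then show ?thesis
      using FG_mod_orbit_rep_zero[OF u y False] by simp
  qed
  finally show "u y = (\<Oplus>\<^bsub>FG_mod G M S\<^esub>x\<in>supp u \<inter> orbit_reps. gamma G M S x (u x)) y"
    by simp
qed

end

section \<open>Functoriality of \<open>F\<^sup>G(-, M)\<close>\<close>

lemma linear_maps_hom: "h \<in> linear_maps R M N \<Longrightarrow> h \<in> hom (add_monoid M) (add_monoid N)"
  by (simp add: linear_maps_def)

text \<open>Phrased as a homomorphism so that \<open>finsum_hom\<close> can move a scalar across a
  finite sum and signs can be composed with face maps.\<close>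

lemma (in coefficient_gset) smult_hom_FG_mod:
  assumes r: "r \<in> carrier R"
  shows "(\<lambda>v. r \<odot>\<^bsub>FG_mod G M S\<^esub> v) \<in> hom (add_monoid (FG_mod G M S)) (add_monoid (FG_mod G M S))"
proof -
  have "r \<odot>\<^bsub>FG_mod G M S\<^esub> (u \<oplus>\<^bsub>FG_mod G M S\<^esub> v) =
      r \<odot>\<^bsub>FG_mod G M S\<^esub> u \<oplus>\<^bsub>FG_mod G M S\<^esub> r \<odot>\<^bsub>FG_mod G M S\<^esub> v"
    if u: "u \<in> carrier (FG_mod G M S)" and v: "v \<in> carrier (FG_mod G M S)" for u v
    unfolding FG_mod_simps(2,3) F_mod_simps
    using Module.module.smult_r_distr[OF module_at r] F_mod_app[OF FG_mod_F_mod[OF u]]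
      F_mod_app[OF FG_mod_F_mod[OF v]]
    by (intro restrict_ext) simp
  then show ?thesis
    by (simp add: hom_def smult_mem_FG_mod r)
qed

locale coefficient_gset_map =
  S: coefficient_gset G R M S + T: coefficient_gset G R M T
  for G :: "('g, 'b) monoid_scheme" and R :: "('r, 'c) ring_scheme" and M :: "('g, 'r, 'm) coeff"
    and S :: "('g, 's) gset" and T :: "('g, 't) gset" +
  fixes f :: "'s \<Rightarrow> 't"
  assumes f_mem: "x \<in> elems S \<Longrightarrow> f x \<in> elems T"
    and f_act: "g \<in> carrier G \<Longrightarrow> x \<in> elems S \<Longrightarrow> f (act S g x) = act T g (f x)"
    and f_base: "f (base S) = base T"
begin

section \<open>Coefficients along the canonical projections of orbits\<close>

definition push :: "'s \<Rightarrow> 'm \<Rightarrow> 'm" where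
  "push x = Mor M (isotropy G S x) (isotropy G T (f x))
     (orbit_map G (isotropy G S x) (isotropy G T (f x)) \<one>\<^bsub>G\<^esub>)"

lemma push_eq_orbit_hom: "push x = S.orbit_hom (isotropy G S x) (isotropy G T (f x)) \<one>\<^bsub>G\<^esub>"
  by (simp add: push_def S.orbit_hom_def)

lemma isotropy_le: "x \<in> elems S \<Longrightarrow> g \<in> isotropy G S x \<Longrightarrow> g \<in> isotropy G T (f x)"
  using f_act[of g x] by (simp add: S.mem_isotropy T.mem_isotropy)

lemma push_admissible:
  assumes "x \<in> elems S"
  shows "S.orbit_admissible (isotropy G S x) (isotropy G T (f x)) \<one>\<^bsub>G\<^esub>"
  unfolding S.orbit_admissible_def
  using assms isotropy_le[OF assms]
  by (auto simp: S.subgroup_isotropy T.subgroup_isotropy f_mem S.mem_isotropy)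

lemma push_closed:
  "x \<in> elems S \<Longrightarrow> l \<in> carrier (Ob M (isotropy G S x)) \<Longrightarrow>
     push x l \<in> carrier (Ob M (isotropy G T (f x)))"
  by (simp add: push_eq_orbit_hom S.orbit_hom_closed push_admissible)

lemma push_add:
  "x \<in> elems S \<Longrightarrow> l \<in> carrier (Ob M (isotropy G S x)) \<Longrightarrow> l' \<in> carrier (Ob M (isotropy G S x)) \<Longrightarrow>
     push x (l \<oplus>\<^bsub>Ob M (isotropy G S x)\<^esub> l') = push x l \<oplus>\<^bsub>Ob M (isotropy G T (f x))\<^esub> push x l'"
  by (simp add: push_eq_orbit_hom S.orbit_hom_add push_admissible)

lemma push_smult:
  "x \<in> elems S \<Longrightarrow> r \<in> carrier R \<Longrightarrow> l \<in> carrier (Ob M (isotropy G S x)) \<Longrightarrow>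
     push x (r \<odot>\<^bsub>Ob M (isotropy G S x)\<^esub> l) = r \<odot>\<^bsub>Ob M (isotropy G T (f x))\<^esub> push x l"
  by (simp add: push_eq_orbit_hom S.orbit_hom_smult push_admissible)

lemma push_zero:
  "x \<in> elems S \<Longrightarrow> push x \<zero>\<^bsub>Ob M (isotropy G S x)\<^esub> = \<zero>\<^bsub>Ob M (isotropy G T (f x))\<^esub>"
  by (simp add: push_eq_orbit_hom S.orbit_hom_zero push_admissible)

text \<open>Naturality of the projections: they have label \<open>\<one>\<close>, so both ways
  around the square of isotropy groups have label \<open>inv g\<close>.\<close>

lemma push_transl:
  assumes x: "x \<in> elems S" and g: "g \<in> carrier G" and l: "l \<in> carrier (Ob M (isotropy G S x))"
  shows "push (act S g x) (transl G M S g x l) = transl G M T g (f x) (push x l)"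
proof -
  define H where "H = isotropy G S x"
  define gH where "gH = isotropy G S (act S g x)"
  define K where "K = isotropy G T (f x)"
  define gK where "gK = isotropy G T (act T g (f x))"
  have 1: "S.orbit_admissible H gH (inv\<^bsub>G\<^esub> g)"
    unfolding H_def gH_def by (rule S.transl_admissible[OF x g])
  have 2: "S.orbit_admissible gH gK \<one>\<^bsub>G\<^esub>"
    unfolding gH_def gK_def using push_admissible[OF S.act_closed[OF g x]] by (simp add: f_act g x)
  have 3: "S.orbit_admissible H K \<one>\<^bsub>G\<^esub>"
    unfolding H_def K_def by (rule push_admissible[OF x])
  have 4: "S.orbit_admissible K gK (inv\<^bsub>G\<^esub> g)"
    unfolding K_def gK_def by (rule T.transl_admissible[OF f_mem[OF x] g])
  have 5: "S.orbit_admissible H gK (inv\<^bsub>G\<^esub> g)"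
    using 1 2 by (simp add: S.orbit_admissible_def H_def gH_def gK_def S.mem_isotropy)
  have one: "\<one>\<^bsub>G\<^esub> \<in> gK"
    using 4 subgroup.one_closed by (auto simp: S.orbit_admissible_def)
  have l': "l \<in> carrier (Ob M H)"
    using l by (simp add: H_def)
  have "S.orbit_hom gH gK \<one>\<^bsub>G\<^esub> (S.orbit_hom H gH (inv\<^bsub>G\<^esub> g) l) = S.orbit_hom H gK (inv\<^bsub>G\<^esub> g) l"
    by (rule S.orbit_hom_comp[OF 1 2 5 _ l']) (use g one in simp)
  moreover have "S.orbit_hom K gK (inv\<^bsub>G\<^esub> g) (S.orbit_hom H K \<one>\<^bsub>G\<^esub> l) = S.orbit_hom H gK (inv\<^bsub>G\<^esub> g) l"
    by (rule S.orbit_hom_comp[OF 3 4 5 _ l']) (use g one in simp)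
  ultimately show ?thesis
    unfolding push_eq_orbit_hom S.transl_eq_orbit_hom T.transl_eq_orbit_hom f_act[OF g x]
    by (simp add: H_def gH_def K_def gK_def)
qed

section \<open>The induced homomorphism: existence and uniqueness\<close>

definition gamma_push :: "'s \<Rightarrow> 'm \<Rightarrow> 't \<Rightarrow> 'm" where
  "gamma_push x l = gamma G M T (f x) (push x l)"

lemma gamma_push_mem:
  "x \<in> elems S \<Longrightarrow> l \<in> carrier (Ob M (isotropy G S x)) \<Longrightarrow> gamma_push x l \<in> carrier (FG_mod G M T)"
  unfolding gamma_push_def by (intro T.gamma_mem f_mem push_closed)

text \<open>
  The pushforward is defined on a chosen set of orbit representatives.  Pushing forward all values of
  \<open>u\<close> along \<open>f\<close> instead would multiply \<open>\<gamma>\<^sup>G\<^sub>x(l)\<close> by the index of \<open>G\<^sub>x\<close> in \<open>G\<^bsub>f(x)\<^esub>\<close>.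
\<close>

definition pushforward :: "('s \<Rightarrow> 'm) \<Rightarrow> 't \<Rightarrow> 'm" where
  "pushforward = (\<lambda>u\<in>carrier (FG_mod G M S).
     \<Oplus>\<^bsub>FG_mod G M T\<^esub>x\<in>S.supp u \<inter> S.orbit_reps. gamma_push x (u x))"

lemma FG_value:
  "u \<in> carrier (FG_mod G M S) \<Longrightarrow> x \<in> S.orbit_reps \<Longrightarrow> u x \<in> carrier (Ob M (isotropy G S x))"
  using S.F_mod_app S.FG_mod_F_mod S.orbit_reps_subset by blast

lemma gamma_push_value_mem:
  "u \<in> carrier (FG_mod G M S) \<Longrightarrow> x \<in> S.orbit_reps \<Longrightarrow>
     gamma_push x (u x) \<in> carrier (FG_mod G M T)"
  using gamma_push_mem FG_value S.orbit_reps_subset by blast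

text \<open>Supports change under addition and scalar multiplication. Enlarging the index set by
  representatives whose terms vanish puts the sums to be compared over one common set.\<close>

lemma pushforward_eq:
  assumes u: "u \<in> carrier (FG_mod G M S)" and I: "finite I" "S.supp u \<inter> S.orbit_reps \<subseteq> I" "I \<subseteq> S.orbit_reps"
  shows "pushforward u = (\<Oplus>\<^bsub>FG_mod G M T\<^esub>x\<in>I. gamma_push x (u x))"
proof -
  interpret FT: abelian_group "FG_mod G M T"
    by (rule T.abelian_group_FG_mod)
  have zero: "gamma_push x (u x) = \<zero>\<^bsub>FG_mod G M T\<^esub>" if "x \<in> I - S.supp u \<inter> S.orbit_reps" for x
  proof -
    have x: "x \<in> elems S" and "x \<notin> S.supp u"
      using that I S.orbit_reps_subset by blast+
    then have "u x = \<zero>\<^bsub>Ob M (isotropy G S x)\<^esub>"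
      by (simp add: S.supp_def)
    then show ?thesis
      by (simp add: gamma_push_def push_zero x T.gamma_zero f_mem)
  qed
  have mem: "(\<lambda>x. gamma_push x (u x)) \<in> I \<rightarrow> carrier (FG_mod G M T)"
  proof (rule funcsetI)
    fix x assume "x \<in> I"
    then show "gamma_push x (u x) \<in> carrier (FG_mod G M T)"
      using gamma_push_value_mem[OF u] I(3) by blast
  qed
  have "(\<Oplus>\<^bsub>FG_mod G M T\<^esub>x\<in>S.supp u \<inter> S.orbit_reps. gamma_push x (u x)) =
      (\<Oplus>\<^bsub>FG_mod G M T\<^esub>x\<in>I. gamma_push x (u x))"
    by (rule FT.add.finprod_mono_neutral_cong_left[OF I(1,2) zero refl mem])
  then show ?thesis
    using u by (simp add: pushforward_def)
qed

lemma pushforward_mem: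
  assumes u: "u \<in> carrier (FG_mod G M S)"
  shows "pushforward u \<in> carrier (FG_mod G M T)"
proof -
  interpret FT: abelian_group "FG_mod G M T"
    by (rule T.abelian_group_FG_mod)
  have "(\<lambda>x. gamma_push x (u x)) \<in> S.supp u \<inter> S.orbit_reps \<rightarrow> carrier (FG_mod G M T)"
    by (rule funcsetI) (simp add: gamma_push_value_mem[OF u])
  then show ?thesis
    using FT.finsum_closed u by (simp add: pushforward_def)
qed

lemma finite_supp: "u \<in> carrier (FG_mod G M S) \<Longrightarrow> finite (S.supp u)"
  using S.FG_mod_F_mod by (auto simp: S.F_mod_mem)

lemma pushforward_linear: "pushforward \<in> linear_maps R (FG_mod G M S) (FG_mod G M T)"
proof -
  interpret FT: abelian_group "FG_mod G M T"
    by (rule T.abelian_group_FG_mod)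
  have "pushforward (u \<oplus>\<^bsub>FG_mod G M S\<^esub> v) = pushforward u \<oplus>\<^bsub>FG_mod G M T\<^esub> pushforward v"
    if u: "u \<in> carrier (FG_mod G M S)" and v: "v \<in> carrier (FG_mod G M S)" for u v
  proof -
    define w where "w = u \<oplus>\<^bsub>FG_mod G M S\<^esub> v"
    have w: "w \<in> carrier (FG_mod G M S)"
      unfolding w_def using u v by (rule S.add_mem_FG_mod)
    define I where "I = (S.supp u \<union> S.supp v \<union> S.supp w) \<inter> S.orbit_reps"
    have I: "finite I" "I \<subseteq> S.orbit_reps"
      unfolding I_def using finite_supp u v w by simp_all
    have sub: "S.supp u \<inter> S.orbit_reps \<subseteq> I" "S.supp v \<inter> S.orbit_reps \<subseteq> I" "S.supp w \<inter> S.orbit_reps \<subseteq> I"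
      unfolding I_def by blast+
    have mem: "gamma_push x (u x) \<in> carrier (FG_mod G M T)" "gamma_push x (v x) \<in> carrier (FG_mod G M T)"
      if "x \<in> I" for x
      using that I(2) gamma_push_value_mem[OF u] gamma_push_value_mem[OF v] by blast+
    have "gamma_push x (w x) = gamma_push x (u x) \<oplus>\<^bsub>FG_mod G M T\<^esub> gamma_push x (v x)" if "x \<in> I" for x
    proof -
      have xr: "x \<in> S.orbit_reps"
        using that I by blast
      then have x: "x \<in> elems S"
        using S.orbit_reps_subset by blast
      have vals: "u x \<in> carrier (Ob M (isotropy G S x))" "v x \<in> carrier (Ob M (isotropy G S x))"
        using FG_value[OF u xr] FG_value[OF v xr] .
      have "w x = u x \<oplus>\<^bsub>Ob M (isotropy G S x)\<^esub> v x"
        by (simp add: w_def S.FG_mod_simps(2) S.F_mod_simps x)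
      then show ?thesis
        using vals by (simp add: gamma_push_def push_add x T.gamma_add f_mem push_closed)
    qed
    then have "pushforward w = (\<Oplus>\<^bsub>FG_mod G M T\<^esub>x\<in>I. gamma_push x (u x) \<oplus>\<^bsub>FG_mod G M T\<^esub> gamma_push x (v x))"
      unfolding pushforward_eq[OF w I(1) sub(3) I(2)] using mem by (intro FT.finsum_cong') auto
    also have "\<dots> = pushforward u \<oplus>\<^bsub>FG_mod G M T\<^esub> pushforward v"
      unfolding pushforward_eq[OF u I(1) sub(1) I(2)] pushforward_eq[OF v I(1) sub(2) I(2)]
      using mem by (intro FT.finsum_addf) auto
    finally show ?thesis
      by (simp add: w_def)
  qed
  moreover have "pushforward (r \<odot>\<^bsub>FG_mod G M S\<^esub> u) = r \<odot>\<^bsub>FG_mod G M T\<^esub> pushforward u"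
    if r: "r \<in> carrier R" and u: "u \<in> carrier (FG_mod G M S)" for r u
  proof -
    define w where "w = r \<odot>\<^bsub>FG_mod G M S\<^esub> u"
    have w: "w \<in> carrier (FG_mod G M S)"
      unfolding w_def using r u by (rule S.smult_mem_FG_mod)
    define I where "I = (S.supp u \<union> S.supp w) \<inter> S.orbit_reps"
    have I: "finite I" "I \<subseteq> S.orbit_reps"
      unfolding I_def using finite_supp u w by simp_all
    have sub: "S.supp u \<inter> S.orbit_reps \<subseteq> I" "S.supp w \<inter> S.orbit_reps \<subseteq> I"
      unfolding I_def by blast+
    have mem: "gamma_push x (u x) \<in> carrier (FG_mod G M T)" if "x \<in> I" for x
      using that I(2) gamma_push_value_mem[OF u] by blast
    have smult_hom: "(\<lambda>v. r \<odot>\<^bsub>FG_mod G M T\<^esub> v) \<in> hom (add_monoid (FG_mod G M T)) (add_monoid (FG_mod G M T))"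
      by (rule T.smult_hom_FG_mod[OF r])
    have "r \<odot>\<^bsub>FG_mod G M T\<^esub> gamma_push x (u x) = gamma_push x (w x)" if "x \<in> I" for x
    proof -
      have xr: "x \<in> S.orbit_reps"
        using that I by blast
      then have x: "x \<in> elems S"
        using S.orbit_reps_subset by blast
      have val: "u x \<in> carrier (Ob M (isotropy G S x))"
        using FG_value[OF u xr] .
      have "w x = r \<odot>\<^bsub>Ob M (isotropy G S x)\<^esub> u x"
        by (simp add: w_def S.FG_mod_simps(3) S.F_mod_simps x)
      then show ?thesis
        using val r by (simp add: gamma_push_def push_smult x T.gamma_smult f_mem push_closed)
    qed
    then have "pushforward w = (\<Oplus>\<^bsub>FG_mod G M T\<^esub>x\<in>I. r \<odot>\<^bsub>FG_mod G M T\<^esub> gamma_push x (u x))"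
      unfolding pushforward_eq[OF w I(1) sub(2) I(2)] using gamma_push_value_mem[OF w] I(2)
      by (intro FT.finsum_cong') auto
    also have "\<dots> = r \<odot>\<^bsub>FG_mod G M T\<^esub> pushforward u"
      unfolding pushforward_eq[OF u I(1) sub(1) I(2)]
    proof (rule finsum_hom[symmetric, where h = "\<lambda>v. r \<odot>\<^bsub>FG_mod G M T\<^esub> v", OF FT.abelian_monoid_axioms
          FT.abelian_monoid_axioms smult_hom])
      show "r \<odot>\<^bsub>FG_mod G M T\<^esub> \<zero>\<^bsub>FG_mod G M T\<^esub> = \<zero>\<^bsub>FG_mod G M T\<^esub>"
        by (rule hom_zero[where h = "\<lambda>v. r \<odot>\<^bsub>FG_mod G M T\<^esub> v",
              OF FT.abelian_group_axioms FT.abelian_group_axioms smult_hom])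
      show "(\<lambda>x. gamma_push x (u x)) \<in> I \<rightarrow> carrier (FG_mod G M T)"
        using mem by (rule funcsetI)
    qed
    finally show ?thesis
      by (simp add: w_def)
  qed
  ultimately show ?thesis
    by (simp add: linear_maps_def hom_def pushforward_mem)
qed

text \<open>The defining sum sees only the representative gx of the orbit of x, where the generator
  has the translated value of l. \<open>push_transl\<close> carries the translation to T, and
  \<open>gamma_transl\<close> removes it. At the base point both sides are zero because f is
  pointed.\<close>

lemma pushforward_gamma:
  assumes x: "x \<in> elems S" and l: "l \<in> carrier (Ob M (isotropy G S x))"
  shows "pushforward (gamma G M S x l) = gamma G M T (f x) (push x l)"
proof -
  interpret FT: abelian_group "FG_mod G M T"
    by (rule T.abelian_group_FG_mod)
  show ?thesis
  proof (cases "x = base S")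
    case True
    have "pushforward \<zero>\<^bsub>FG_mod G M S\<^esub> = \<zero>\<^bsub>FG_mod G M T\<^esub>"
      by (rule hom_zero[OF S.abelian_group_FG_mod T.abelian_group_FG_mod
            linear_maps_hom[OF pushforward_linear]])
    moreover have "gamma G M T (base T) (push x l) = \<zero>\<^bsub>FG_mod G M T\<^esub>"
      using T.gamma_base push_closed[OF x l] True by (simp add: f_base)
    ultimately show ?thesis
      using True S.gamma_base l by (simp add: f_base)
  next
    case False
    define u where "u = gamma G M S x l"
    have u: "u \<in> carrier (FG_mod G M S)"
      unfolding u_def using x l by (rule S.gamma_mem)
    obtain g where g: "g \<in> carrier G" "S.orbit_rep x = act S g x"
      using S.orbit_repE[OF x] .
    have rep: "S.orbit_rep x \<in> S.orbit_reps"
      using x by (simp add: S.orbit_reps_def)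
    have "S.supp u \<inter> S.orbit_reps \<subseteq> {S.orbit_rep x}"
    proof
      fix y assume y: "y \<in> S.supp u \<inter> S.orbit_reps"
      then have "y \<in> elems S" "u y \<noteq> \<zero>\<^bsub>Ob M (isotropy G S y)\<^esub>"
        by (simp_all add: S.supp_def)
      then have "y \<in> S.orb x"
        using S.gamma_off_orbit[OF x l] u_def by blast
      then have "S.orbit_rep y = S.orbit_rep x"
        using S.orbit_rep_act[OF x] by (auto simp: S.orb_iff)
      then show "y \<in> {S.orbit_rep x}"
        using S.orbit_rep_self y by simp
    qed
    then have "pushforward u =
        (\<Oplus>\<^bsub>FG_mod G M T\<^esub>y\<in>{S.orbit_rep x}. gamma_push y (u y))"
      using pushforward_eq[OF u] rep by simp
    also have "\<dots> = gamma_push (S.orbit_rep x) (u (S.orbit_rep x))"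
      using gamma_push_value_mem[OF u rep] by (simp add: FT.finsum_insert)
    also have "\<dots> = gamma G M T (act T g (f x)) (transl G M T g (f x) (push x l))"
      using S.gamma_act[OF x l False g(1)] g x l
      by (simp add: u_def gamma_push_def push_transl f_act)
    also have "\<dots> = gamma G M T (f x) (push x l)"
      by (rule T.gamma_transl[OF f_mem[OF x] push_closed[OF x l] g(1)])
    finally show ?thesis
      by (simp add: u_def)
  qed
qed

text \<open>The uniqueness half: every invariant function is a finite sum of generators, so additive
  maps agreeing on generators agree everywhere.\<close>

lemma linear_map_eqI:
  assumes h: "h \<in> linear_maps R (FG_mod G M S) (FG_mod G M T)"
      and k: "k \<in> linear_maps R (FG_mod G M S) (FG_mod G M T)"
    and eq: "\<And>x l. x \<in> elems S \<Longrightarrow> l \<in> carrier (Ob M (isotropy G S x)) \<Longrightarrow>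
      h (gamma G M S x l) = k (gamma G M S x l)"
    and u: "u \<in> carrier (FG_mod G M S)"
  shows "h u = k u"
proof -
  let ?I = "S.supp u \<inter> S.orbit_reps"
  have x: "x \<in> elems S" "u x \<in> carrier (Ob M (isotropy G S x))" if "x \<in> ?I" for x
  proof -
    show "x \<in> elems S"
      using that by (simp add: S.supp_def)
    show "u x \<in> carrier (Ob M (isotropy G S x))"
      using that by (intro FG_value[OF u]) simp
  qed
  have mem: "(\<lambda>x. gamma G M S x (u x)) \<in> ?I \<rightarrow> carrier (FG_mod G M S)"
  proof (rule funcsetI)
    fix x assume "x \<in> ?I"
    then show "gamma G M S x (u x) \<in> carrier (FG_mod G M S)"
      by (intro S.gamma_mem x)
  qed
  have expand: "j u = (\<Oplus>\<^bsub>FG_mod G M T\<^esub>x\<in>?I. j (gamma G M S x (u x)))"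
    if "j \<in> linear_maps R (FG_mod G M S) (FG_mod G M T)" for j
    using finsum_hom[OF abelian_group.axioms(1)[OF S.abelian_group_FG_mod]
        abelian_group.axioms(1)[OF T.abelian_group_FG_mod] linear_maps_hom[OF that]
        hom_zero[OF S.abelian_group_FG_mod T.abelian_group_FG_mod linear_maps_hom[OF that]] mem]
      S.FG_mod_decomposition[OF u]
    by simp
  interpret FT: abelian_group "FG_mod G M T"
    by (rule T.abelian_group_FG_mod)
  have "k (gamma G M S x (u x)) \<in> carrier (FG_mod G M T)" if "x \<in> ?I" for x
    using linear_maps_hom[OF k] S.gamma_mem[OF x[OF that]] by (auto simp: hom_def)
  then show ?thesis
    unfolding expand[OF h] expand[OF k] using eq x by (intro FT.finsum_cong') auto
qed

text \<open>From here on the definite description can be computed with. Extensionality settles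
  arguments outside the carrier, where linearity says nothing.\<close>

lemma FG_map_eq_pushforward: "FG_map R G M S T f = pushforward"
  unfolding FG_map_def push_def[symmetric]
proof (rule the_equality)
  show "pushforward \<in> linear_maps R (FG_mod G M S) (FG_mod G M T) \<and>
    pushforward \<in> extensional (carrier (FG_mod G M S)) \<and>
    (\<forall>x\<in>elems S. \<forall>l\<in>carrier (Ob M (isotropy G S x)).
       pushforward (gamma G M S x l) = gamma G M T (f x) (push x l))"
    using pushforward_linear pushforward_gamma by (simp add: pushforward_def)
next
  fix h
  assume h: "h \<in> linear_maps R (FG_mod G M S) (FG_mod G M T) \<and>
    h \<in> extensional (carrier (FG_mod G M S)) \<and>
    (\<forall>x\<in>elems S. \<forall>l\<in>carrier (Ob M (isotropy G S x)).
       h (gamma G M S x l) = gamma G M T (f x) (push x l))"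
  have gam: "h (gamma G M S x l) = pushforward (gamma G M S x l)"
    if "x \<in> elems S" "l \<in> carrier (Ob M (isotropy G S x))" for x l
    using h that by (simp add: pushforward_gamma)
  show "h = pushforward"
  proof (rule extensionalityI)
    show "h \<in> extensional (carrier (FG_mod G M S))"
      using h by blast
    show "pushforward \<in> extensional (carrier (FG_mod G M S))"
      by (simp add: pushforward_def)
    fix u assume "u \<in> carrier (FG_mod G M S)"
    then show "h u = pushforward u"
      using linear_map_eqI[OF conjunct1[OF h] pushforward_linear gam] by simp
  qed
qed

end

section \<open>Path components of fixed point spaces\<close>

lemma path_component_of_map_image:
  "path_component_of X x y \<Longrightarrow> continuous_map X Z f \<Longrightarrow> path_component_of Z (f x) (f y)"
  unfolding path_component_of_def by (metis comp_apply pathin_compose)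

section \<open>Disks and their boundary spheres\<close>

lemma topspace_disk: "topspace (subtopology (Euclidean_space n) (disk n)) = disk n"
  by (auto simp: topspace_Euclidean_space disk_def)

lemma disk_boundary_subset: "disk_boundary n \<subseteq> disk n"
  by (auto simp: disk_def disk_boundary_def)

text \<open>Applied to each coordinate and summed, this gives convexity of the disk without a norm
  on sequences.\<close>

lemma square_convex_comb_le:
  fixes a b s :: real
  assumes "0 \<le> s" "s \<le> 1"
  shows "((1 - s) * a + s * b)\<^sup>2 \<le> (1 - s) * a\<^sup>2 + s * b\<^sup>2"
proof -
  have "(1 - s) * a\<^sup>2 + s * b\<^sup>2 - ((1 - s) * a + s * b)\<^sup>2 = s * (1 - s) * (a - b)\<^sup>2"
    by (simp add: power2_eq_square algebra_simps)
  moreover have "0 \<le> s * (1 - s) * (a - b)\<^sup>2"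
    using assms by simp
  ultimately show ?thesis
    by linarith
qed

lemma disk_convex:
  assumes a: "a \<in> disk n" and b: "b \<in> disk n" and s: "0 \<le> s" "s \<le> 1"
  shows "(\<lambda>i. (1 - s) * a i + s * b i) \<in> disk n"
proof -
  have "(\<Sum>i<n. ((1 - s) * a i + s * b i)\<^sup>2) \<le> (\<Sum>i<n. (1 - s) * (a i)\<^sup>2 + s * (b i)\<^sup>2)"
    by (intro sum_mono square_convex_comb_le s)
  also have "\<dots> = (1 - s) * (\<Sum>i<n. (a i)\<^sup>2) + s * (\<Sum>i<n. (b i)\<^sup>2)"
    by (simp add: sum.distrib sum_distrib_left)
  also have "\<dots> \<le> (1 - s) * 1 + s * 1"
    using a b s by (intro add_mono mult_left_mono) (auto simp: disk_def)
  finally show ?thesis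
    using a b by (simp add: disk_def)
qed

lemma path_connected_space_disk: "path_connected_space (subtopology (Euclidean_space n) (disk n))"
  unfolding path_connected_space_def topspace_disk
proof (intro ballI)
  fix a b assume a: "a \<in> disk n" and b: "b \<in> disk n"
  have "pathin (subtopology (Euclidean_space n) (disk n)) (\<lambda>s i. (1 - s) * a i + s * b i)"
    unfolding pathin_def Euclidean_space_def subtopology_subtopology continuous_map_in_subtopology
      continuous_map_componentwise_UNIV
  proof (intro conjI allI)
    show "continuous_map (top_of_set {0..1}) euclideanreal (\<lambda>s. (1 - s) * a k + s * b k)" for k
      by (simp add: continuous_intros)
    show "(\<lambda>s i. (1 - s) * a i + s * b i) \<in> topspace (top_of_set {0..1}) \<rightarrow> {x. \<forall>i\<ge>n. x i = 0} \<inter> disk n"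
      using disk_convex[OF a b] a b by (auto simp: disk_def)
  qed
  then show "\<exists>g. pathin (subtopology (Euclidean_space n) (disk n)) g \<and> g 0 = a \<and> g 1 = b"
    by (intro exI[of _ "\<lambda>s i. (1 - s) * a i + s * b i"]) simp
qed

lemma closedin_disk_boundary:
  "closedin (subtopology (Euclidean_space n) (disk n)) (disk_boundary n)"
proof -
  have "continuous_map (subtopology (Euclidean_space n) (disk n)) euclideanreal (\<lambda>x. \<Sum>i<n. (x i)\<^sup>2)"
    unfolding Euclidean_space_def subtopology_subtopology
    by (intro continuous_map_from_subtopology continuous_map_sum continuous_map_real_pow
        continuous_map_product_coordinates) auto
  then have "closedin (subtopology (Euclidean_space n) (disk n))
      {x \<in> topspace (subtopology (Euclidean_space n) (disk n)). (\<Sum>i<n. (x i)\<^sup>2) \<in> {1}}"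
    by (rule closedin_continuous_map_preimage) simp
  moreover have "{x \<in> topspace (subtopology (Euclidean_space n) (disk n)). (\<Sum>i<n. (x i)\<^sup>2) \<in> {1}} = disk_boundary n"
    unfolding topspace_disk by (auto simp: disk_def disk_boundary_def)
  ultimately show ?thesis
    by simp
qed

text \<open>
  A translate \<open>C\<close> of an equivariant cell either lies in the fixed point set, and then in a single
  path component of it, or meets the fixed point set only in its boundary.
\<close>

lemma closedin_cell_slice:
  fixes G (structure)
  assumes G: "group G" and H: "subgroup H G"
    and cells: "attaches_G_cells G Y \<psi> n cells A B" and cell: "(L, \<Phi>) \<in> cells"
    and C: "C \<in> lcosets L"
    and Q: "Q \<subseteq> fixed_points Y \<psi> H"
    and Q_path: "\<forall>y z. y \<in> Q \<longrightarrow> path_component_of (subtopology Y (fixed_points Y \<psi> H)) y z \<longrightarrow> z \<in> Q"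
    and closed: "closedin (subtopology Y A) (Q \<inter> A)"
  shows "closedin (subtopology (Euclidean_space n) (disk n)) {t \<in> disk n. \<Phi> (C, t) \<in> Q}"
proof -
  let ?D = "subtopology (Euclidean_space n) (disk n)"
  have L: "subgroup L G" and cont: "continuous_map (G_cell G n L) (subtopology Y B) \<Phi>"
    and equiv: "\<And>g C t. g \<in> carrier G \<Longrightarrow> C \<in> lcosets L \<Longrightarrow> t \<in> disk n \<Longrightarrow>
      \<Phi> (g <# C, t) = \<psi> g (\<Phi> (C, t))"
    and bdry: "\<Phi> ` ((lcosets L) \<times> disk_boundary n) \<subseteq> A"
    using cells cell by (fastforce simp: attaches_G_cells_def)+
  have inj: "inj_on (\<lambda>((H, \<Phi>), p). \<Phi> p)
       (SIGMA c:cells. (lcosets (fst c)) \<times> (disk n - disk_boundary n))"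
    using cells by (simp add: attaches_G_cells_def bij_betw_def)
  have slice: "continuous_map ?D (G_cell G n L) (\<lambda>t. (C, t))"
    unfolding G_cell_def using C by (simp add: continuous_map_pairedI)
  have cont_C: "continuous_map ?D (subtopology Y B) (\<lambda>t. \<Phi> (C, t))"
    using continuous_map_compose[OF slice cont] by (simp add: o_def)
  then have cont_Y: "continuous_map ?D Y (\<lambda>t. \<Phi> (C, t))"
    by (simp add: continuous_map_in_subtopology)
  show ?thesis
  proof (cases "\<forall>h\<in>H. h <# C = C")
    case True
    have "\<Phi> (C, t) \<in> fixed_points Y \<psi> H" if t: "t \<in> disk n" for t
    proof -
      have "\<Phi> (C, t) \<in> topspace Y"
        using continuous_map_funspace[OF cont_Y] t unfolding topspace_disk by auto
      moreover have "\<psi> h (\<Phi> (C, t)) = \<Phi> (C, t)" if "h \<in> H" for h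
        using equiv[OF subgroup.mem_carrier[OF H that] C t] True that by simp
      ultimately show ?thesis
        by (simp add: fixed_points_def)
    qed
    then have contF: "continuous_map ?D (subtopology Y (fixed_points Y \<psi> H)) (\<lambda>t. \<Phi> (C, t))"
      using cont_Y unfolding continuous_map_in_subtopology topspace_disk by auto
    \<comment> \<open>The disk is path connected and its slice maps into the fixed point set, so the
      image lies in one path component: the preimage of Q is all of the disk or empty.\<close>
    have "\<Phi> (C, t') \<in> Q" if "t \<in> disk n" "t' \<in> disk n" "\<Phi> (C, t) \<in> Q" for t t'
    proof -
      have "path_component_of ?D t t'"
        using path_connected_space_imp_path_component_of[OF path_connected_space_disk, unfolded topspace_disk]
          that(1,2) .
      then show ?thesis
        using Q_path that(3) path_component_of_map_image[OF _ contF] by blast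
    qed
    then have "{t \<in> disk n. \<Phi> (C, t) \<in> Q} = {} \<or> {t \<in> disk n. \<Phi> (C, t) \<in> Q} = topspace ?D"
      unfolding topspace_disk by blast
    then show ?thesis
      using closedin_topspace[of ?D] closedin_empty[of ?D] by (elim disjE) (simp_all only:)
  next
    case False
    then obtain h where h: "h \<in> H" "h <# C \<noteq> C"
      by blast
    have hG: "h \<in> carrier G"
      using subgroup.mem_carrier[OF H h(1)] .
    obtain a where a: "a \<in> carrier G" "C = a <# L"
      using C by (auto simp: LCOSETS_def)
    have hC: "h <# C \<in> lcosets L"
      using group.lcos_m_assoc[OF G subgroup.subset[OF L] hG a(1)] monoid.m_closed[OF group.is_monoid[OF G] hG a(1)] a(2)
      by (auto simp: LCOSETS_def)
    \<comment> \<open>At an interior t with image in Q, the distinct cosets C and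
      \<open>h <# C\<close> would give two points of the open cells with the same image, contrary to
      injectivity of the characteristic maps there.\<close>
    have "t \<in> disk_boundary n" if t: "t \<in> disk n" "\<Phi> (C, t) \<in> Q" for t
    proof (rule ccontr)
      assume "t \<notin> disk_boundary n"
      then have mem: "((L, \<Phi>), (h <# C, t)) \<in> (SIGMA c:cells. (lcosets (fst c)) \<times> (disk n - disk_boundary n))"
        "((L, \<Phi>), (C, t)) \<in> (SIGMA c:cells. (lcosets (fst c)) \<times> (disk n - disk_boundary n))"
        using cell t C hC by auto
      have "\<Phi> (h <# C, t) = \<Phi> (C, t)"
        using equiv[OF hG C t(1)] t(2) Q h(1) by (auto simp: fixed_points_def)
      then have "(\<lambda>((H, \<Phi>), p). \<Phi> p) ((L, \<Phi>), (h <# C, t)) = (\<lambda>((H, \<Phi>), p). \<Phi> p) ((L, \<Phi>), (C, t))"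
        by simp
      then have "((L, \<Phi>), (h <# C, t)) = ((L, \<Phi>), (C, t))"
        using mem by (rule inj_onD[OF inj])
      then show False
        using h(2) by simp
    qed
    moreover have bA: "\<Phi> (C, t) \<in> A" if "t \<in> disk_boundary n" for t
      using bdry C that by blast
    ultimately have eq: "{t \<in> disk n. \<Phi> (C, t) \<in> Q} = {t \<in> disk_boundary n. \<Phi> (C, t) \<in> Q \<inter> A}"
      using disk_boundary_subset by blast
    have top: "topspace (subtopology ?D (disk_boundary n)) = disk_boundary n"
      unfolding topspace_subtopology[of ?D] topspace_disk using disk_boundary_subset by blast
    \<comment> \<open>The attaching map into A pulls the closed set \<open>Q \<inter> A\<close> back
      to a closed subset of the sphere, and the sphere is closed in the disk.\<close>
    have cont_A: "continuous_map (subtopology ?D (disk_boundary n)) (subtopology Y A) (\<lambda>t. \<Phi> (C, t))"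
      unfolding continuous_map_in_subtopology top
      using continuous_map_from_subtopology[OF cont_Y] bA by blast
    have "closedin (subtopology ?D (disk_boundary n)) {t \<in> disk_boundary n. \<Phi> (C, t) \<in> Q \<inter> A}"
      using closedin_continuous_map_preimage[OF cont_A closed] unfolding top .
    then show ?thesis
      unfolding eq using closedin_disk_boundary by (rule closedin_trans_full)
  qed
qed

text \<open>The pushout topology tests closedness on A and on each equivariant cell. As G is finite,
  such a cell is a finite union of disks, so closedness can be checked one coset at a time.\<close>

lemma closedin_attach_step:
  fixes G (structure)
  assumes G: "group G" and fin: "finite (carrier G)" and H: "subgroup H G"
    and cells: "attaches_G_cells G Y \<psi> n cells A B"
    and Q: "Q \<subseteq> fixed_points Y \<psi> H"
    and Q_path: "\<forall>y z. y \<in> Q \<longrightarrow> path_component_of (subtopology Y (fixed_points Y \<psi> H)) y z \<longrightarrow> z \<in> Q"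
    and closed: "closedin (subtopology Y A) (Q \<inter> A)"
  shows "closedin (subtopology Y B) (Q \<inter> B)"
proof -
  have AB: "A \<subseteq> B"
    using cells by (simp add: attaches_G_cells_def)
  have top: "W \<subseteq> B \<Longrightarrow> closedin (subtopology Y B) W \<longleftrightarrow>
          closedin (subtopology Y A) (W \<inter> A) \<and>
          (\<forall>(L, \<Phi>) \<in> cells. closedin (G_cell G n L) {p \<in> topspace (G_cell G n L). \<Phi> p \<in> W})" for W
    using cells by (simp add: attaches_G_cells_def)
  have "closedin (G_cell G n L) {p \<in> topspace (G_cell G n L). \<Phi> p \<in> Q \<inter> B}"
    if cell: "(L, \<Phi>) \<in> cells" for L \<Phi>
  proof -
    have topcell: "topspace (G_cell G n L) = (lcosets L) \<times> disk n"
      by (simp add: G_cell_def topspace_disk del: topspace_subtopology)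
    have cont: "continuous_map (G_cell G n L) (subtopology Y B) \<Phi>"
      using cells cell by (fastforce simp: attaches_G_cells_def)
    have "\<Phi> p \<in> B" if "p \<in> (lcosets L) \<times> disk n" for p
      using continuous_map_funspace[OF cont] that unfolding topcell by auto
    then have "{p \<in> topspace (G_cell G n L). \<Phi> p \<in> Q \<inter> B} =
        (\<Union>C\<in>lcosets L. {C} \<times> {t \<in> disk n. \<Phi> (C, t) \<in> Q})"
      unfolding topcell by auto
    moreover have "closedin (G_cell G n L) ({C} \<times> {t \<in> disk n. \<Phi> (C, t) \<in> Q})" if "C \<in> lcosets L" for C
      unfolding G_cell_def closedin_prod_Times_iff
      using closedin_cell_slice[OF G H cells cell that Q Q_path closed] that by simp
    moreover have "finite (lcosets L)"
      unfolding LCOSETS_def using fin by simp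
    ultimately show ?thesis
      by (simp only:) (intro closedin_Union; auto)
  qed
  moreover have "closedin (subtopology Y A) (Q \<inter> B \<inter> A)"
    using closed AB by (simp add: inf.absorb2 inf_assoc)
  ultimately show ?thesis
    by (subst top) auto
qed

text \<open>Saturation refers to paths in the whole fixed point set of Y, not in a skeleton, so it
  is a fixed hypothesis throughout the induction and components of different skeleta are never
  compared. The induction starts at the empty stage \<open>K 0\<close>.\<close>

lemma closedin_path_saturated_fixed_points:
  fixes G (structure)
  assumes G: "group G" and fin: "finite (carrier G)" and H: "subgroup H G"
    and CW: "G_CW_complex G Y \<psi>"
    and Q: "Q \<subseteq> fixed_points Y \<psi> H"
    and Q_path: "\<forall>y z. y \<in> Q \<longrightarrow> path_component_of (subtopology Y (fixed_points Y \<psi> H)) y z \<longrightarrow> z \<in> Q"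
  shows "closedin Y Q"
proof -
  obtain K cells where K0: "K 0 = {}"
    and att: "\<And>n. attaches_G_cells G Y \<psi> n (cells n) (K n) (K (Suc n))"
    and top: "\<And>W. W \<subseteq> topspace Y \<Longrightarrow> closedin Y W \<longleftrightarrow> (\<forall>n. closedin (subtopology Y (K n)) (W \<inter> K n))"
    using CW unfolding G_CW_complex_def by auto
  have "closedin (subtopology Y (K n)) (Q \<inter> K n)" for n
  proof (induction n)
    case 0
    then show ?case
      by (simp add: K0)
  next
    case (Suc n)
    then show ?case
      by (rule closedin_attach_step[OF G fin H att Q Q_path])
  qed
  moreover have "Q \<subseteq> topspace Y"
    using Q by (auto simp: fixed_points_def)
  ultimately show ?thesis
    using top by blast
qed

section \<open>Fixed points under equivariant maps and homotopies\<close>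

lemma equivariant_fixed_points:
  assumes "continuous_map X Y f" "equivariant G (topspace X) \<phi> \<psi> f" "subgroup H G"
  shows "f \<in> fixed_points X \<phi> H \<rightarrow> fixed_points Y \<psi> H"
proof
  fix x assume x: "x \<in> fixed_points X \<phi> H"
  then have xX: "x \<in> topspace X" and hx: "\<And>h. h \<in> H \<Longrightarrow> \<phi> h x = x"
    by (simp_all add: fixed_points_def)
  have "\<psi> h (f x) = f x" if h: "h \<in> H" for h
  proof -
    have "f (\<phi> h x) = \<psi> h (f x)"
      using assms(2) xX subgroup.mem_carrier[OF assms(3) h] unfolding equivariant_def by blast
    then show ?thesis
      by (simp add: hx[OF h])
  qed
  moreover have "f x \<in> topspace Y"
    using continuous_map_funspace[OF assms(1)] x by (auto simp: fixed_points_def)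
  ultimately show "f x \<in> fixed_points Y \<psi> H"
    by (simp add: fixed_points_def)
qed

lemma continuous_map_fixed_points:
  assumes "continuous_map X Y f" "equivariant G (topspace X) \<phi> \<psi> f" "subgroup H G"
  shows "continuous_map (subtopology X (fixed_points X \<phi> H)) (subtopology Y (fixed_points Y \<psi> H)) f"
  unfolding continuous_map_in_subtopology
  using equivariant_fixed_points[OF assms] continuous_map_from_subtopology[OF assms(1)] by auto

text \<open>Every stage of the homotopy is equivariant, so the track of an H-fixed point never
  leaves the fixed point set. This track is the path.\<close>

lemma G_homotopic_path_component:
  assumes hom: "G_homotopic G X \<phi> X \<phi> p id" and H: "subgroup H G"
    and x: "x \<in> fixed_points X \<phi> H"
  shows "path_component_of (subtopology X (fixed_points X \<phi> H)) (p x) x"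
proof -
  obtain k where k: "continuous_map (prod_topology (top_of_set {0..1::real}) X) X k"
    and k0: "\<And>x. k (0, x) = p x" and k1: "\<And>x. k (1, x) = x"
    and eq: "\<And>t. t \<in> {0..1} \<Longrightarrow> equivariant G (topspace X) \<phi> \<phi> (\<lambda>x. k (t, x))"
    using hom unfolding G_homotopic_def homotopic_with_def by auto
  have xX: "x \<in> topspace X" and hx: "\<And>h. h \<in> H \<Longrightarrow> \<phi> h x = x"
    using x by (simp_all add: fixed_points_def)
  have "continuous_map (top_of_set {0..1}) (prod_topology (top_of_set {0..1::real}) X) (\<lambda>t. (t, x))"
    using xX by (simp add: continuous_map_pairedI)
  then have c: "continuous_map (top_of_set {0..1}) X (\<lambda>t. k (t, x))"
    using continuous_map_compose[OF _ k] by (fastforce simp: o_def)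
  have "k (t, x) \<in> fixed_points X \<phi> H" if t: "t \<in> {0..1}" for t
  proof -
    have "k (t, x) \<in> topspace X"
      using continuous_map_funspace[OF c] t by auto
    moreover have "\<phi> h (k (t, x)) = k (t, x)" if h: "h \<in> H" for h
    proof -
      have "k (t, \<phi> h x) = \<phi> h (k (t, x))"
        using eq[OF t] xX subgroup.mem_carrier[OF H h] unfolding equivariant_def by blast
      then show ?thesis
        by (simp add: hx[OF h])
    qed
    ultimately show ?thesis
      by (simp add: fixed_points_def)
  qed
  then have "pathin (subtopology X (fixed_points X \<phi> H)) (\<lambda>t. k (t, x))"
    unfolding pathin_def continuous_map_in_subtopology using c by auto
  then show ?thesis
    unfolding path_component_of_def using k0 k1 by (intro exI[of _ "\<lambda>t. k (t, x)"]) simp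
qed

lemma fixed_points_path_component:
  fixes G (structure)
  assumes G: "group G" and fin: "finite (carrier G)" and H: "subgroup H G"
    and CW: "G_CW_complex G Y \<psi>" and equiv: "G_homotopy_equivalent G X \<phi> Y \<psi>"
    and conn: "connectedin X (fixed_points X \<phi> H)"
    and x: "x \<in> fixed_points X \<phi> H" and y: "y \<in> fixed_points X \<phi> H"
  shows "path_component_of (subtopology X (fixed_points X \<phi> H)) x y"
proof -
  let ?XH = "subtopology X (fixed_points X \<phi> H)" and ?YH = "subtopology Y (fixed_points Y \<psi> H)"
  obtain f h where f: "continuous_map X Y f" "equivariant G (topspace X) \<phi> \<psi> f"
    and h: "continuous_map Y X h" "equivariant G (topspace Y) \<psi> \<phi> h"
    and hf: "G_homotopic G X \<phi> X \<phi> (h \<circ> f) id"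
    using equiv by (auto simp: G_homotopy_equivalent_def)
  have fH: "f z \<in> fixed_points Y \<psi> H" if "z \<in> fixed_points X \<phi> H" for z
    using equivariant_fixed_points[OF f H] that by blast
  have topYH: "topspace ?YH = fixed_points Y \<psi> H"
    by (auto simp: fixed_points_def)
  define P where "P = Collect (path_component_of ?YH (f x))"
  have P: "P \<subseteq> fixed_points Y \<psi> H"
    unfolding P_def using path_component_of_subset_topspace[of ?YH "f x"] topYH by simp
  have closed1: "closedin Y P"
    by (rule closedin_path_saturated_fixed_points[OF G fin H CW P])
      (unfold P_def, blast intro: path_component_of_trans)
  \<comment> \<open>By symmetry of the path relation the complement of a component is again path
    saturated, so the same closedness result applies and P is separated from the rest by two closed
    sets.\<close>
  have closed2: "closedin Y (fixed_points Y \<psi> H - P)"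
  proof (rule closedin_path_saturated_fixed_points[OF G fin H CW]; (intro allI impI)?)
    fix a b assume a: "a \<in> fixed_points Y \<psi> H - P" and ab: "path_component_of ?YH a b"
    have "b \<in> topspace ?YH"
      using ab by (simp add: path_component_of_equiv)
    then have "b \<in> fixed_points Y \<psi> H"
      by (simp only: topYH)
    moreover have "b \<notin> P"
      using a path_component_of_trans[of ?YH "f x" b a] path_component_of_sym[OF ab] by (auto simp: P_def)
    ultimately show "b \<in> fixed_points Y \<psi> H - P"
      by simp
  qed simp
  have "f x \<in> P"
    using fH[OF x] topYH by (simp add: P_def path_component_of_refl)
  then have "P \<inter> f ` fixed_points X \<phi> H \<noteq> {}"
    using x by blast
  moreover have "f ` fixed_points X \<phi> H \<subseteq> P \<union> (fixed_points Y \<psi> H - P)"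
    using fH by blast
  moreover have "P \<inter> (fixed_points Y \<psi> H - P) \<inter> f ` fixed_points X \<phi> H = {}"
    by blast
  moreover have "connectedin Y (f ` fixed_points X \<phi> H)"
    using connectedin_continuous_map_image[OF f(1) conn] .
  ultimately have "(fixed_points Y \<psi> H - P) \<inter> f ` fixed_points X \<phi> H = {}"
    using closed1 closed2 unfolding connectedin_closedin by meson
  then have "f y \<in> P"
    using fH[OF y] y by blast
  then have "path_component_of ?YH (f x) (f y)"
    by (simp add: P_def)
  then have "path_component_of ?XH (h (f x)) (h (f y))"
    by (rule path_component_of_map_image[OF _ continuous_map_fixed_points[OF h H]])
  \<comment> \<open>The transported path joins \<open>h (f x)\<close> to \<open>h (f y)\<close>; the
    tracks of the homotopy from \<open>h \<circ> f\<close> to the identity close the gaps at both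
    ends.\<close>
  moreover have "path_component_of ?XH x (h (f x))"
    using path_component_of_sym[OF G_homotopic_path_component[OF hf H x]] by simp
  moreover have "path_component_of ?XH (h (f y)) y"
    using G_homotopic_path_component[OF hf H y] by simp
  ultimately show ?thesis
    by (blast intro: path_component_of_trans)
qed

section \<open>Chains in degrees 0 and 1\<close>

lemma group_action_singular_gset:
  assumes X: "G_space G X \<phi>"
  shows "group_action G (elems (singular_gset X \<phi> x0 q)) (act (singular_gset X \<phi> x0 q))"
proof -
  have action: "group_action G (topspace X) \<phi>"
    and cont: "\<And>g. g \<in> carrier G \<Longrightarrow> continuous_map X X (\<phi> g)"
    using X by (simp_all add: G_space_def)
  interpret group G
    using action group_action.group_hom group_hom.axioms(1) by blast
  define S where "S = singular_simplex_set q X"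
  define a where "a = (\<lambda>g. \<lambda>\<sigma>\<in>S. simplex_map q (\<phi> g) \<sigma>)"
  have closed: "simplex_map q (\<phi> g) \<sigma> \<in> S" if "g \<in> carrier G" "\<sigma> \<in> S" for g \<sigma>
    using singular_simplex_simplex_map cont that by (fastforce simp: S_def)
  have mult: "simplex_map q (\<phi> (g \<otimes>\<^bsub>G\<^esub> h)) \<sigma> = simplex_map q (\<phi> g) (simplex_map q (\<phi> h) \<sigma>)"
    if "g \<in> carrier G" "h \<in> carrier G" "\<sigma> \<in> S" for g h \<sigma>
  proof -
    have "simplex_map q (\<phi> (g \<otimes>\<^bsub>G\<^esub> h)) \<sigma> = simplex_map q (\<phi> g \<circ> \<phi> h) \<sigma>"
      using that group_action.composition_rule[OF action]
      by (intro simplex_map_eq[of q X]) (simp_all add: S_def)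
    then show ?thesis
      by (simp add: simplex_map_compose)
  qed
  have one: "simplex_map q (\<phi> \<one>\<^bsub>G\<^esub>) \<sigma> = \<sigma>" if "\<sigma> \<in> S" for \<sigma>
    using that group_action.id_eq_one[OF action, symmetric]
    by (intro simplex_map_id_gen[of q X]) (simp_all add: S_def)
  \<comment> \<open>Elements of \<open>Bij S\<close> are extensional bijections, which is why the
    action on simplices is restricted to S.\<close>
  have bij: "a g \<in> Bij S" if g: "g \<in> carrier G" for g
  proof -
    have "bij_betw (a g) S S"
    proof (rule bij_betw_byWitness[where f' = "a (inv\<^bsub>G\<^esub> g)"])
      show "\<forall>\<sigma>\<in>S. a (inv\<^bsub>G\<^esub> g) (a g \<sigma>) = \<sigma>" "\<forall>\<sigma>\<in>S. a g (a (inv\<^bsub>G\<^esub> g) \<sigma>) = \<sigma>"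
        using g by (simp_all add: a_def closed mult[symmetric] one)
      show "a g ` S \<subseteq> S" "a (inv\<^bsub>G\<^esub> g) ` S \<subseteq> S"
        using g closed by (auto simp: a_def)
    qed
    then show ?thesis
      by (simp add: Bij_def a_def)
  qed
  have "a \<in> hom G (BijGroup S)"
  proof (rule homI)
    show "a g \<in> carrier (BijGroup S)" if "g \<in> carrier G" for g
      using bij[OF that] by (simp add: BijGroup_def)
    show "a (g \<otimes>\<^bsub>G\<^esub> h) = a g \<otimes>\<^bsub>BijGroup S\<^esub> a h" if "g \<in> carrier G" "h \<in> carrier G" for g h
    proof -
      have "a (g \<otimes>\<^bsub>G\<^esub> h) = compose S (a g) (a h)"
        using that closed mult by (intro extensionalityI[of _ S]) (simp_all add: a_def compose_def)
      then show ?thesis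
        using bij that by (simp add: BijGroup_def)
    qed
  qed
  then have "group_action G S a"
    by (intro group_action.intro group_hom.intro group_hom_axioms.intro group_BijGroup is_group)
  then show ?thesis
    by (simp add: singular_gset_def S_def a_def)
qed

lemma coefficient_gset_singular:
  assumes G: "group G" and fin: "finite (carrier G)" and R: "cring R" and M: "coefficient_system R G M"
    and X: "pointed_G_space G X \<phi> x0"
  shows "coefficient_gset G R M (singular_gset X \<phi> x0 q)"
proof -
  have x0: "x0 \<in> topspace X" "\<And>g. g \<in> carrier G \<Longrightarrow> \<phi> g x0 = x0" and XG: "G_space G X \<phi>"
    using X by (simp_all add: pointed_G_space_def)
  have base: "(\<lambda>t\<in>standard_simplex q. x0) \<in> singular_simplex_set q X"
    using x0 by (auto simp: singular_simplex_def intro: continuous_map_eq[of _ _ "\<lambda>_. x0"])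
  interpret finite_coefficient_system G R M
    by (intro finite_coefficient_system.intro finite_coefficient_system_axioms.intro assms)
  show ?thesis
  proof (intro coefficient_gset.intro coefficient_gset_axioms.intro finite_coefficient_system_axioms)
    show "group_action G (elems (singular_gset X \<phi> x0 q)) (act (singular_gset X \<phi> x0 q))"
      by (rule group_action_singular_gset[OF XG])
    show "base (singular_gset X \<phi> x0 q) \<in> elems (singular_gset X \<phi> x0 q)"
      using base by (simp add: singular_gset_def)
    fix g assume "g \<in> carrier G"
    then show "act (singular_gset X \<phi> x0 q) g (base (singular_gset X \<phi> x0 q)) = base (singular_gset X \<phi> x0 q)"
      using base x0 by (auto simp: singular_gset_def simplex_map_def)
  qed
qed

text \<open>Faces precompose with a map of standard simplices, while G postcomposes with a self-map
  of X; hence the two commute.\<close>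

lemma coefficient_gset_map_face:
  assumes G: "group G" and fin: "finite (carrier G)" and R: "cring R" and M: "coefficient_system R G M"
    and X: "pointed_G_space G X \<phi> x0" and q: "1 \<le> q" and i: "i \<le> q"
  shows "coefficient_gset_map G R M (singular_gset X \<phi> x0 q) (singular_gset X \<phi> x0 (q - 1)) (singular_face q i)"
proof -
  have face: "singular_simplex (q - Suc 0) X (singular_face q i \<sigma>)" if "singular_simplex q X \<sigma>" for \<sigma>
    using singular_simplex_singular_face[OF that q i] .
  have in_simplex: "simplical_face i t \<in> standard_simplex q" if "t \<in> standard_simplex (q - Suc 0)" for t :: "nat \<Rightarrow> real"
    using simplical_face_in_standard_simplex[OF q i that] .
  show ?thesis
  proof (intro coefficient_gset_map.intro coefficient_gset_singular[OF G fin R M X]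
      coefficient_gset_map_axioms.intro)
    show "singular_face q i \<sigma> \<in> elems (singular_gset X \<phi> x0 (q - 1))"
      if "\<sigma> \<in> elems (singular_gset X \<phi> x0 q)" for \<sigma>
      using that face by (simp add: singular_gset_def)
    show "singular_face q i (act (singular_gset X \<phi> x0 q) g \<sigma>) =
        act (singular_gset X \<phi> x0 (q - 1)) g (singular_face q i \<sigma>)"
      if "g \<in> carrier G" "\<sigma> \<in> elems (singular_gset X \<phi> x0 q)" for g \<sigma>
    proof -
      have "singular_face q i (simplex_map q (\<phi> g) \<sigma>) = simplex_map (q - Suc 0) (\<phi> g) (singular_face q i \<sigma>)"
        unfolding singular_face_simplex_map[OF q i] unfolding simplex_map_def singular_face_def
        by (rule restrict_ext) simp
      then show ?thesis
        using that face by (simp add: singular_gset_def)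
    qed
    show "singular_face q i (base (singular_gset X \<phi> x0 q)) = base (singular_gset X \<phi> x0 (q - 1))"
      using in_simplex by (auto simp: singular_gset_def singular_face_def)
  qed
qed

lemma (in coefficient_gset) smult_one_FG_mod:
  assumes u: "u \<in> carrier (FG_mod G M S)"
  shows "\<one>\<^bsub>R\<^esub> \<odot>\<^bsub>FG_mod G M S\<^esub> u = u"
proof (rule F_mod_ext)
  show "\<one>\<^bsub>R\<^esub> \<odot>\<^bsub>FG_mod G M S\<^esub> u \<in> carrier (F_mod G M S)"
    by (rule FG_mod_F_mod[OF smult_mem_FG_mod[OF R.one_closed u]])
  show "u \<in> carrier (F_mod G M S)"
    by (rule FG_mod_F_mod[OF u])
  fix x assume x: "x \<in> elems S"
  show "(\<one>\<^bsub>R\<^esub> \<odot>\<^bsub>FG_mod G M S\<^esub> u) x = u x"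
    using Module.module.smult_one[OF module_at[OF x] F_mod_app[OF FG_mod_F_mod[OF u] x]] x
    by (simp add: FG_mod_simps(3) F_mod_simps(3))
qed

section \<open>The differential on reduced equivariant chains\<close>

locale pointed_coefficient_space =
  fixes G :: "('g, 'b) monoid_scheme" and R :: "('r, 'c) ring_scheme" and M :: "('g, 'r, 'm) coeff"
    and X :: "'x topology" and \<phi> :: "'g \<Rightarrow> 'x \<Rightarrow> 'x" and x0 :: 'x
  assumes G: "group G" and fin: "finite (carrier G)" and R: "cring R" and M: "coefficient_system R G M"
    and X: "pointed_G_space G X \<phi> x0"
begin

abbreviation sing :: "nat \<Rightarrow> ('g, (nat \<Rightarrow> real) \<Rightarrow> 'x) gset" where
  "sing \<equiv> singular_gset X \<phi> x0"

abbreviation chain :: "nat \<Rightarrow> ('r, ((nat \<Rightarrow> real) \<Rightarrow> 'x) \<Rightarrow> 'm) module" where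
  "chain \<equiv> bredon_chain G M X \<phi> x0"

abbreviation diff :: "nat \<Rightarrow> (((nat \<Rightarrow> real) \<Rightarrow> 'x) \<Rightarrow> 'm) \<Rightarrow> ((nat \<Rightarrow> real) \<Rightarrow> 'x) \<Rightarrow> 'm" where
  "diff \<equiv> bredon_differential R G M X \<phi> x0"

lemma gset_sing: "coefficient_gset G R M (sing q)"
  by (rule coefficient_gset_singular[OF G fin R M X])

lemma abelian_group_chain: "abelian_group (chain q)"
  unfolding bredon_chain_def by (rule coefficient_gset.abelian_group_FG_mod[OF gset_sing])

lemma smult_hom_chain:
  "r \<in> carrier R \<Longrightarrow> (\<lambda>v. r \<odot>\<^bsub>chain q\<^esub> v) \<in> hom (add_monoid (chain q)) (add_monoid (chain q))"
  unfolding bredon_chain_def by (rule coefficient_gset.smult_hom_FG_mod[OF gset_sing])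

text \<open>A signed summand of the differential, isolated so that additivity can be proved summand
  by summand.\<close>

definition face_term :: "nat \<Rightarrow> nat \<Rightarrow> (((nat \<Rightarrow> real) \<Rightarrow> 'x) \<Rightarrow> 'm) \<Rightarrow> ((nat \<Rightarrow> real) \<Rightarrow> 'x) \<Rightarrow> 'm" where
  "face_term q i u = ((\<ominus>\<^bsub>R\<^esub> \<one>\<^bsub>R\<^esub>) [^]\<^bsub>R\<^esub> i) \<odot>\<^bsub>chain (q - 1)\<^esub>
     FG_map R G M (sing q) (sing (q - 1)) (singular_face q i) u"

lemma smult_zero_chain:
  "r \<in> carrier R \<Longrightarrow> r \<odot>\<^bsub>chain q\<^esub> \<zero>\<^bsub>chain q\<^esub> = \<zero>\<^bsub>chain q\<^esub>"
  by (rule hom_zero[where h = "\<lambda>v. r \<odot>\<^bsub>chain q\<^esub> v", OF abelian_group_chain abelian_group_chain])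
    (rule smult_hom_chain)

lemma sign_closed: "(\<ominus>\<^bsub>R\<^esub> \<one>\<^bsub>R\<^esub>) [^]\<^bsub>R\<^esub> (i :: nat) \<in> carrier R"
proof -
  interpret R: cring R
    by (rule R)
  show ?thesis
    by simp
qed

lemma face_term_hom:
  assumes q: "1 \<le> q" and i: "i \<le> q"
  shows "face_term q i \<in> hom (add_monoid (chain q)) (add_monoid (chain (q - 1)))"
proof -
  interpret d: coefficient_gset_map G R M "sing q" "sing (q - 1)" "singular_face q i"
    by (rule coefficient_gset_map_face[OF G fin R M X q i])
  have "d.pushforward \<in> hom (add_monoid (chain q)) (add_monoid (chain (q - 1)))"
    unfolding bredon_chain_def by (rule linear_maps_hom[OF d.pushforward_linear])
  from Group.hom_compose[OF this smult_hom_chain[OF sign_closed[of i]]]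
  show ?thesis
    unfolding face_term_def[abs_def] d.FG_map_eq_pushforward o_def .
qed

lemma diff_eq: "1 \<le> q \<Longrightarrow> diff q u = (\<Oplus>\<^bsub>chain (q - 1)\<^esub>i\<in>{..q}. face_term q i u)"
  by (simp add: bredon_differential_def face_term_def Let_def)

lemma diff_hom:
  assumes q: "1 \<le> q"
  shows "diff q \<in> hom (add_monoid (chain q)) (add_monoid (chain (q - 1)))"
proof -
  interpret C: abelian_group "chain (q - 1)"
    by (rule abelian_group_chain)
  have mem: "face_term q i u \<in> carrier (chain (q - 1))" if "i \<le> q" "u \<in> carrier (chain q)" for i u
    using face_term_hom[OF q that(1)] that(2) by (auto simp: hom_def)
  have add: "face_term q i (u \<oplus>\<^bsub>chain q\<^esub> v) = face_term q i u \<oplus>\<^bsub>chain (q - 1)\<^esub> face_term q i v"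
    if "i \<le> q" "u \<in> carrier (chain q)" "v \<in> carrier (chain q)" for i u v
    using face_term_hom[OF q that(1)] that(2,3) by (auto simp: hom_def)
  show ?thesis
  proof (rule homI)
    fix u assume "u \<in> carrier (add_monoid (chain q))"
    then have "(\<lambda>i. face_term q i u) \<in> {..q} \<rightarrow> carrier (chain (q - 1))"
      using mem by simp
    then show "diff q u \<in> carrier (add_monoid (chain (q - 1)))"
      unfolding diff_eq[OF q] using C.finsum_closed by simp
  next
    fix u v assume "u \<in> carrier (add_monoid (chain q))" "v \<in> carrier (add_monoid (chain q))"
    then have u: "u \<in> carrier (chain q)" and v: "v \<in> carrier (chain q)"
      by simp_all
    have "diff q (u \<oplus>\<^bsub>chain q\<^esub> v) =
        (\<Oplus>\<^bsub>chain (q - 1)\<^esub>i\<in>{..q}. face_term q i u \<oplus>\<^bsub>chain (q - 1)\<^esub> face_term q i v)"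
      unfolding diff_eq[OF q]
    proof (rule C.finsum_cong'[OF refl])
      show "(\<lambda>i. face_term q i u \<oplus>\<^bsub>chain (q - 1)\<^esub> face_term q i v) \<in> {..q} \<rightarrow> carrier (chain (q - 1))"
        by (intro funcsetI C.a_closed mem u v) simp_all
    qed (simp add: add[OF _ u v])
    also have "\<dots> = diff q u \<oplus>\<^bsub>chain (q - 1)\<^esub> diff q v"
      unfolding diff_eq[OF q] by (rule C.finsum_addf) (simp_all add: mem[OF _ u, simplified] mem[OF _ v, simplified])
    finally show "diff q (u \<otimes>\<^bsub>add_monoid (chain q)\<^esub> v) = diff q u \<otimes>\<^bsub>add_monoid (chain (q - 1))\<^esub> diff q v"
      by simp
  qed
qed

lemma gamma_boundary:
  assumes paths: "\<And>H x. subgroup H G \<Longrightarrow> x \<in> fixed_points X \<phi> H \<Longrightarrow>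
      path_component_of (subtopology X (fixed_points X \<phi> H)) x0 x"
    and x: "x \<in> elems (sing 0)" and l: "l \<in> carrier (Ob M (isotropy G (sing 0) x))"
  shows "gamma G M (sing 0) x l \<in> diff 1 ` carrier (chain 1)"
proof -
  interpret d0: coefficient_gset_map G R M "sing 1" "sing 0" "singular_face 1 0"
    using coefficient_gset_map_face[OF G fin R M X, of 1 0] by simp
  interpret d1: coefficient_gset_map G R M "sing 1" "sing 0" "singular_face 1 1"
    using coefficient_gset_map_face[OF G fin R M X, of 1 1] by simp
  interpret C: abelian_group "chain 0"
    by (rule abelian_group_chain)
  \<comment> \<open>The only point of the standard 0-simplex, so a 0-simplex amounts to its value p
    at e.\<close>
  define e :: "nat \<Rightarrow> real" where "e = (\<lambda>i. if i = 0 then 1 else 0)"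
  have e: "standard_simplex 0 = {e}"
    by (simp add: e_def standard_simplex_0)
  have x_ext: "x \<in> extensional {e}" and x_cont: "continuous_map (subtopology (powertop_real UNIV) {e}) X x"
    using x by (simp_all add: singular_gset_def singular_simplex_def e)
  define p where "p = x e"
  have pX: "p \<in> topspace X"
    using continuous_map_funspace[OF x_cont] by (auto simp: p_def)
  define H where "H = isotropy G (sing 0) x"
  have H: "subgroup H G"
    unfolding H_def by (rule d0.T.subgroup_isotropy[OF x])
  have act_x: "act (sing 0) g x = (\<lambda>t\<in>{e}. \<phi> g p)" for g
    using x by (auto simp: singular_gset_def simplex_map_def e p_def)
  have Hp: "\<phi> h p = p" if "h \<in> H" for h
  proof -
    have "(\<lambda>t\<in>{e}. \<phi> h p) = x"
      using that by (simp add: H_def d0.T.mem_isotropy act_x)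
    then show ?thesis
      using p_def by (metis restrict_apply' singletonI)
  qed
  have "p \<in> fixed_points X \<phi> H"
    using pX Hp by (simp add: fixed_points_def)
  then obtain c where c: "pathin (subtopology X (fixed_points X \<phi> H)) c" "c 0 = x0" "c 1 = p"
    using paths[OF H] unfolding path_component_of_def by blast
  then have c_cont: "continuous_map (top_of_set {0..1}) X c"
    and c_fix: "\<And>s. s \<in> {0..1} \<Longrightarrow> c s \<in> fixed_points X \<phi> H"
    unfolding pathin_def continuous_map_in_subtopology by auto
  \<comment> \<open>Coordinate 1 parametrises the edge. It is 1 on face 0 and 0 on face 1, so
    running the path from x0 to p puts x on the face with positive sign and the base simplex on the
    other.\<close>
  define \<sigma> where "\<sigma> = (\<lambda>t\<in>standard_simplex 1. c (t (1::nat)))"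
  have coord: "t 1 \<in> {0..1}" if "t \<in> standard_simplex 1" for t :: "nat \<Rightarrow> real"
    using that by (simp add: standard_simplex_def)
  have "continuous_map (subtopology (powertop_real UNIV) (standard_simplex 1)) (top_of_set {0..1}) (\<lambda>t. t 1)"
    unfolding continuous_map_in_subtopology
    using coord by (auto intro: continuous_map_from_subtopology continuous_map_product_coordinates)
  then have "continuous_map (subtopology (powertop_real UNIV) (standard_simplex 1)) X (\<lambda>t. c (t 1))"
    using continuous_map_compose[OF _ c_cont] by (fastforce simp: o_def)
  then have "continuous_map (subtopology (powertop_real UNIV) (standard_simplex 1)) X \<sigma>"
    by (rule continuous_map_eq) (simp add: \<sigma>_def)
  then have \<sigma>: "\<sigma> \<in> elems (sing 1)"
    by (simp add: singular_gset_def singular_simplex_def \<sigma>_def)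
  have in1: "simplical_face k t \<in> standard_simplex 1" if "t \<in> standard_simplex 0" "k \<le> 1" for t :: "nat \<Rightarrow> real" and k
    using simplical_face_in_standard_simplex[of 1 k t] that by simp
  have face0: "singular_face 1 0 \<sigma> = x"
  proof (rule extensionalityI[OF _ x_ext])
    show "singular_face 1 0 \<sigma> \<in> extensional {e}"
      by (simp add: singular_face_def e)
    show "singular_face 1 0 \<sigma> t = x t" if "t \<in> {e}" for t
      using that in1[of t 0] c(3)
      by (simp add: singular_face_def e \<sigma>_def p_def) (simp add: simplical_face_def e_def)
  qed
  have face1: "singular_face 1 1 \<sigma> = base (sing 0)"
  proof (rule extensionalityI[of _ "{e}"])
    show "singular_face 1 1 \<sigma> \<in> extensional {e}" "base (sing 0) \<in> extensional {e}"
      by (simp_all add: singular_face_def singular_gset_def e)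
    show "singular_face 1 1 \<sigma> t = base (sing 0) t" if "t \<in> {e}" for t
      using that in1[of t 1] c(2)
      by (simp add: singular_face_def e \<sigma>_def singular_gset_def) (simp add: simplical_face_def)
  qed
  \<comment> \<open>Whatever fixes the simplex fixes its face x, which gives one inclusion. The
    other holds because every point of the path is fixed by H.\<close>
  have iso: "isotropy G (sing 1) \<sigma> = H"
  proof
    show "isotropy G (sing 1) \<sigma> \<subseteq> H"
      using d0.isotropy_le[OF \<sigma>, unfolded face0] unfolding H_def by blast
    show "H \<subseteq> isotropy G (sing 1) \<sigma>"
    proof
      fix h assume h: "h \<in> H"
      have "\<phi> h (\<sigma> t) = \<sigma> t" if "t \<in> standard_simplex 1" for t
        using c_fix[OF coord[OF that]] h that by (simp add: \<sigma>_def fixed_points_def)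
      then have "act (sing 1) h \<sigma> = \<sigma>"
        using \<sigma> by (auto simp: singular_gset_def simplex_map_def \<sigma>_def intro!: restrict_ext)
      then show "h \<in> isotropy G (sing 1) \<sigma>"
        unfolding d0.S.mem_isotropy using subgroup.mem_carrier[OF H h] by blast
    qed
  qed
  have l\<sigma>: "l \<in> carrier (Ob M (isotropy G (sing 1) \<sigma>))"
    unfolding iso H_def by (rule l)
  \<comment> \<open>Since simplex and face have the same isotropy group, the projection of orbits is
    the identity and l is unchanged.\<close>
  have push: "d0.push \<sigma> l = l"
    unfolding d0.push_eq_orbit_hom face0 iso H_def[symmetric]
    using l by (intro d0.S.orbit_hom_id H subgroup.one_closed) (simp add: H_def)
  let ?\<gamma> = "gamma G M (sing 1) \<sigma> l"
  have \<gamma>: "?\<gamma> \<in> carrier (chain 1)"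
    unfolding bredon_chain_def by (rule d0.S.gamma_mem[OF \<sigma> l\<sigma>])
  have \<gamma>x: "gamma G M (sing 0) x l \<in> carrier (chain 0)"
    unfolding bredon_chain_def by (rule d0.T.gamma_mem[OF x l])
  have face_term: "face_term 1 i u = ((\<ominus>\<^bsub>R\<^esub> \<one>\<^bsub>R\<^esub>) [^]\<^bsub>R\<^esub> i) \<odot>\<^bsub>chain 0\<^esub>
      FG_map R G M (sing 1) (sing 0) (singular_face 1 i) u" for i u
    by (simp add: face_term_def)
  have "face_term 1 0 ?\<gamma> = \<one>\<^bsub>R\<^esub> \<odot>\<^bsub>chain 0\<^esub> gamma G M (sing 0) x l"
    unfolding face_term d0.FG_map_eq_pushforward d0.pushforward_gamma[OF \<sigma> l\<sigma>] face0 push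
    by (simp add: d0.S.R.nat_pow_0)
  also have "\<dots> = gamma G M (sing 0) x l"
    using d0.T.smult_one_FG_mod[OF d0.T.gamma_mem[OF x l]] by (simp add: bredon_chain_def)
  finally have term0: "face_term 1 0 ?\<gamma> = gamma G M (sing 0) x l" .
  \<comment> \<open>Generators at the base simplex vanish, so the end at x0 leaves no correction
    term; this is the effect of working with reduced chains.\<close>
  have "d1.pushforward ?\<gamma> = \<zero>\<^bsub>chain 0\<^esub>"
    using d1.pushforward_gamma[OF \<sigma> l\<sigma>] d0.T.gamma_base d1.push_closed[OF \<sigma> l\<sigma>]
    unfolding face1 by (simp add: bredon_chain_def)
  then have term1: "face_term 1 1 ?\<gamma> = \<zero>\<^bsub>chain 0\<^esub>"
    unfolding face_term d1.FG_map_eq_pushforward by (simp only: smult_zero_chain[OF sign_closed])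
  have "diff 1 ?\<gamma> = (\<Oplus>\<^bsub>chain 0\<^esub>i\<in>{0, 1}. face_term 1 i ?\<gamma>)"
    using diff_eq[of 1 ?\<gamma>] by (simp add: atMost_Suc insert_commute)
  also have "\<dots> = gamma G M (sing 0) x l"
    using \<gamma>x term0 term1 by (simp add: C.finsum_insert)
  finally show ?thesis
    using \<gamma> by (metis imageI)
qed

text \<open>The differential is additive, so preimages chosen for the finitely many generators in
  the decomposition of u add up to a preimage of u.\<close>

lemma diff_surj:
  assumes paths: "\<And>H x. subgroup H G \<Longrightarrow> x \<in> fixed_points X \<phi> H \<Longrightarrow>
      path_component_of (subtopology X (fixed_points X \<phi> H)) x0 x"
  shows "diff 1 ` carrier (chain 1) = carrier (chain 0)"
proof
  have hom: "diff 1 \<in> hom (add_monoid (chain 1)) (add_monoid (chain 0))"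
    using diff_hom[of 1] by simp
  then show "diff 1 ` carrier (chain 1) \<subseteq> carrier (chain 0)"
    by (auto simp: hom_def)
  interpret S: coefficient_gset G R M "sing 0"
    by (rule gset_sing)
  interpret C1: abelian_group "chain 1"
    by (rule abelian_group_chain)
  interpret C0: abelian_group "chain 0"
    by (rule abelian_group_chain)
  show "carrier (chain 0) \<subseteq> diff 1 ` carrier (chain 1)"
  proof
    fix u assume "u \<in> carrier (chain 0)"
    then have u: "u \<in> carrier (FG_mod G M (sing 0))"
      by (simp add: bredon_chain_def)
    define I where "I = S.supp u \<inter> S.orbit_reps"
    have "\<forall>x\<in>I. \<exists>w. w \<in> carrier (chain 1) \<and> diff 1 w = gamma G M (sing 0) x (u x)"
    proof
      fix x assume "x \<in> I"
      then have x: "x \<in> elems (sing 0)"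
        by (simp add: I_def S.supp_def)
      show "\<exists>w. w \<in> carrier (chain 1) \<and> diff 1 w = gamma G M (sing 0) x (u x)"
        using gamma_boundary[OF paths x S.F_mod_app[OF S.FG_mod_F_mod[OF u] x]] by auto
    qed
    then obtain w where w: "\<And>x. x \<in> I \<Longrightarrow> w x \<in> carrier (chain 1)"
      and dw: "\<And>x. x \<in> I \<Longrightarrow> diff 1 (w x) = gamma G M (sing 0) x (u x)"
      by metis
    have wI: "w \<in> I \<rightarrow> carrier (chain 1)"
      using w by blast
    have "diff 1 (finsum (chain 1) w I) = (\<Oplus>\<^bsub>chain 0\<^esub>x\<in>I. diff 1 (w x))"
      by (rule finsum_hom[OF C1.abelian_monoid_axioms C0.abelian_monoid_axioms hom
            hom_zero[OF C1.abelian_group_axioms C0.abelian_group_axioms hom] wI])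
    also have "\<dots> = (\<Oplus>\<^bsub>chain 0\<^esub>x\<in>I. gamma G M (sing 0) x (u x))"
    proof (rule C0.finsum_cong'[OF refl _ dw])
      show "(\<lambda>x. gamma G M (sing 0) x (u x)) \<in> I \<rightarrow> carrier (chain 0)"
      proof (rule funcsetI)
        fix x assume x: "x \<in> I"
        have "diff 1 (w x) \<in> carrier (chain 0)"
          using hom_in_carrier[OF hom] w[OF x] by simp
        then show "gamma G M (sing 0) x (u x) \<in> carrier (chain 0)"
          unfolding dw[OF x] .
      qed
    qed
    also have "\<dots> = u"
      using S.FG_mod_decomposition[OF u] by (simp add: I_def bredon_chain_def)
    finally show "u \<in> diff 1 ` carrier (chain 1)"
      using C1.finsum_closed[OF wI] by (metis imageI)
  qed
qed

lemma homology_0_trivial: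
  assumes surj: "diff 1 ` carrier (chain 1) = carrier (chain 0)"
  shows "carrier (bredon_homology R G M X \<phi> x0 0) = {\<zero>\<^bsub>bredon_homology R G M X \<phi> x0 0\<^esub>}"
proof -
  interpret C: abelian_group "chain 0"
    by (rule abelian_group_chain)
  \<comment> \<open>In degree 0 the truncated subtraction \<open>0 - 1\<close> makes the target the
    0-chains again, and the differential is constantly zero, so every 0-chain is a cycle.\<close>
  have "a_kernel (chain 0) (chain 0) (diff 0) = carrier (chain 0)"
    by (simp add: a_kernel_def kernel_def bredon_differential_def Let_def)
  then have hom: "bredon_homology R G M X \<phi> x0 0 = quotient_module (chain 0) (carrier (chain 0))"
    using surj by (simp add: bredon_homology_def)
  \<comment> \<open>Cycles and boundaries coincide, so the quotient has a single coset, the group of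
    boundaries, which is also its designated zero.\<close>
  have "carrier (chain 0) +>\<^bsub>chain 0\<^esub> u = carrier (chain 0)" if "u \<in> carrier (chain 0)" for u
    using group.coset_join2[OF C.a_group _ group.subgroup_self[OF C.a_group], of u] that
    by (simp add: a_r_coset_def)
  then have "a_rcosets\<^bsub>chain 0\<^esub> (carrier (chain 0)) = {carrier (chain 0)}"
    unfolding A_RCOSETS_def' using C.zero_closed by auto
  then show ?thesis
    by (simp add: hom quotient_module_def)
qed

end

theorem proposition5p14:
  fixes G :: "('g, 'b) monoid_scheme"
    and R :: "('r, 'c) ring_scheme"
    and M :: "('g, 'r, 'm) coeff"
    and X :: "'x topology" and \<phi> :: "'g \<Rightarrow> 'x \<Rightarrow> 'x" and x0 :: 'x
    and Y :: "'y topology" and \<psi> :: "'g \<Rightarrow> 'y \<Rightarrow> 'y"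
  assumes "group G" and "finite (carrier G)"
    and "cring R" and "coefficient_system R G M"
    and "pointed_G_space G X \<phi> x0" and "k_space_wrt TYPE('z) X"
    and "G_CW_complex G Y \<psi>" and "G_homotopy_equivalent G X \<phi> Y \<psi>"
    and "\<And>H. subgroup H G \<Longrightarrow> connectedin X (fixed_points X \<phi> H)"
  shows "carrier (bredon_homology R G M X \<phi> x0 0) = {\<zero>\<^bsub>bredon_homology R G M X \<phi> x0 0\<^esub>}"
proof -
  interpret pointed_coefficient_space G R M X \<phi> x0
    by (intro pointed_coefficient_space.intro assms(1-5))
  have paths: "path_component_of (subtopology X (fixed_points X \<phi> H)) x0 x"
    if H: "subgroup H G" and x: "x \<in> fixed_points X \<phi> H" for H x
  proof -
    \<comment> \<open>The base point is fixed by all of G, so it is a common starting point for the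
      paths in all the fixed point spaces.\<close>
    have "x0 \<in> fixed_points X \<phi> H"
      using assms(5) subgroup.mem_carrier[OF H] by (simp add: pointed_G_space_def fixed_points_def)
    then show ?thesis
      using fixed_points_path_component[OF assms(1,2) H assms(7,8) assms(9)[OF H] _ x] by blast
  qed
  show ?thesis
    by (rule homology_0_trivial[OF diff_surj[OF paths]])
qed

end
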